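(* Every finite-dimensional nilpotent metric first-class $n$-Lie superalgebra $(\mathfrak g,\langle\,,\rangle_{\mathfrak g})$ over an algebraically closed field of characteristic not $2$ is isometric to (a nondegenerate ideal of codimension $1$ of) a $T^*$-extension of a nilpotent first-class $n$-Lie superalgebra whose nilpotent length is at most a half of the nilpotent length of $\mathfrak g$.
   Context: Conventions: whenever $|x|$ appears, $x$ is homogeneous of degree $|x|\in\mathbb Z_2$; a hat means omission; exterior powers are super ($x\wedge y=-(-1)^{|x||y|}y\wedge x$); formulas are extended multilinearly; for homogeneous $x+f\in\mathfrak g\oplus\mathfrak g^*$, $|x+f|=|x|=|f|$. A first-class $n$-Lie superalgebra is a $\mathbb Z_2$-graded vector space $\mathfrak g=\mathfrak g_{\bar0}\oplus\mathfrak g_{\bar1}$ with an $n$-linear bracket such that $|[x_1,\cdots,x_n]|=|x_1|+\cdots+|x_n|$; $[x_1,\cdots,x_i,x_{i+1},\cdots,x_n]=-(-1)^{|x_i||x_{i+1}|}[x_1,\cdots,x_{i+1},x_i,\cdots,x_n]$; and $$[x_1,\cdots,x_{n-1},[y_1,\cdots,y_n]]=\sum_{i=1}^n(-1)^{(|x_1|+\cdots+|x_{n-1}|)(|y_1|+\cdots+|y_{i-1}|)}[y_1,\cdots,[x_1,\cdots,x_{n-1},y_i],\cdots,y_n].$$ For $\mathscr X=x_1\wedge\cdots\wedge x_{n-1}$, $\mathscr Y=y_1\wedge\cdots\wedge y_{n-1}$ put $|\mathscr X|=|x_1|+\cdots+|x_{n-1}|$, $\mathscr X\cdot z=[x_1,\cdots,x_{n-1},z]$,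 $\mathscr X\cdot\mathscr Y=\sum_{i=1}^{n-1}(-1)^{|\mathscr X|(|y_1|+\cdots+|y_{i-1}|)}y_1\wedge\cdots\wedge\mathscr X\cdot y_i\wedge\cdots\wedge y_{n-1}$. Nilpotency: $\mathfrak g^0=\mathfrak g$, $\mathfrak g^{m+1}=[\mathfrak g^m,\mathfrak g,\cdots,\mathfrak g]$; $\mathfrak g$ is nilpotent of (nilpotent) length $k$ if $k$ is the smallest integer with $\mathfrak g^k=0$. Metric: a bilinear form $\langle\,,\rangle$ on $\mathfrak g$ is nondegenerate if $\mathfrak g^\perp=\{x\in\mathfrak g\mid\langle x,y\rangle=0\ \forall y\in\mathfrak g\}=0$; invariant if $\langle\mathscr X\cdot y,z\rangle=-(-1)^{|\mathscr X||y|}\langle y,\mathscr X\cdot z\rangle$; supersymmetric if $\langle x,y\rangle=(-1)^{|x||y|}\langle y,x\rangle$; consistent if $\langle x,y\rangle=0$ for $|x|\ne|y|$. All bilinear forms are assumed consistent. $(\mathfrak g,\langle\,,\rangle)$ is metric if $\langle\,,\rangle$ is nondegenerate, invariant and supersymmetric. Isometric means isomorphic as first-class $n$-Lie superalgebras via an isomorphism preserving the forms. A nondegenerate ideal is one on which the restricted form is nondegenerate. The parenthetical phrase in the claim means that $\mathfrak g$ is isometric either to a $T^*$-extension or to a nondegenerate ideal of codimension $1$ of a $T^*$-extension. $T^*$-extension: the coadjoint action on the dual $\mathfrak g^*$ is $(\mathrm{ad}^*(\mathscr X)f)(z)=-(-1)^{|\mathscr X||f|}f(\mathscr X\cdot z)$.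 For $v\in\mathfrak g^*$ write $[y_1,\cdots,y_{n-1},v]=\mathrm{ad}^*(y_1,\cdots,y_{n-1})v$ and extend to other positions of $v$ by super-skew-symmetry. $Z^1(\mathfrak g,\mathfrak g^* )_{\bar0}$ is the set of degree-$0$ super-skew-symmetric $n$-linear maps $\theta:\mathfrak g^{n}\to\mathfrak g^*$, written $\theta(\mathscr X,z)=\theta(x_1,\cdots,x_{n-1},z)$, with $\delta\theta=0$, where $$\begin{aligned}\delta\theta(\mathscr X,\mathscr Y,z)=&-\theta(\mathscr X\cdot\mathscr Y,z)-(-1)^{|\mathscr X||\mathscr Y|}\theta(\mathscr Y,\mathscr X\cdot z)+\theta(\mathscr X,\mathscr Y\cdot z)+\mathrm{ad}^*(\mathscr X)\theta(\mathscr Y,z)-(-1)^{|\mathscr X||\mathscr Y|}\mathrm{ad}^*(\mathscr Y)\theta(\mathscr X,z)\\&-\sum_{i=1}^{n-1}(-1)^{|\mathscr X|(|y_1|+\cdots+|y_{i-1}|)}[y_1,\cdots,\theta(\mathscr X,y_i),\cdots,y_{n-1},z].\end{aligned}$$ For $\theta\in Z^1(\mathfrak g,\mathfrak g^* )_{\bar0}$ satisfying $\theta(\mathscr X,y)(z)+(-1)^{|y||z|}\theta(\mathscr X,z)(y)=0$, the $T^*$-extension $T^*_\theta\mathfrak g$ of $\mathfrak g$ by $\theta$ is the metric first-class $n$-Lie superalgebra $\mathfrak g\oplus\mathfrak g^*$ with $$[x_1+f_1,\cdots,x_n+f_n]_\theta=[x_1,\cdots,x_n]_{\mathfrak g}+\theta(x_1,\cdots,x_n)+\sum_{i=1}^n(-1)^{n-i}(-1)^{|x_i|(|x_{i+1}|+\cdots+|x_n|)}\mathrm{ad}^*(x_1,\cdots,\widehat{x_i},\cdots,x_n)\cdot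 f_i$$ and $\langle x+f,y+g\rangle_\theta=f(y)+(-1)^{|x||y|}g(x)$.
   Formalization: "At most a half of the nilpotent length" is read as a half rounded up; for odd nilpotent length the literal bound always fails (a one-dimensional abelian algebra of length 1 would need a T*-extension of the zero algebra). *)

theory Defs
  imports
    "HOL-Library.Z2"
    "HOL-Library.Function_Algebras"
    "HOL-Library.Product_Plus"
    "HOL-Computational_Algebra.Polynomial"
begin

section \<open>Graded vector spaces\<close>

text \<open>
  Degrees live in the field \<^typ>\<open>bit\<close> with two elements. The vector space of a
  structure is the subspace \<open>carrier L\<close>, the direct sum of \<open>part L 0\<close> and \<open>part L 1\<close>, of
  the ambient type; the bracket of \<open>x\<^sub>1, \<dots>, x\<^sub>n\<close> is \<open>brk L [x\<^sub>1, \<dots>, x\<^sub>n]\<close> and is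
  only meaningful on lists of length \<open>n\<close> over the carrier.
\<close>

record ('k, 'a) super_alg =
  scal :: "'k \<Rightarrow> 'a \<Rightarrow> 'a"
  part :: "bit \<Rightarrow> 'a set"
  brk :: "'a list \<Rightarrow> 'a"

text \<open>\<open>sg d\<close> is \<open>(-1)\<^sup>d\<close>.\<close>

definition sg :: "bit \<Rightarrow> 'k::field" where
  "sg d = (if d = 0 then 1 else - 1)"

definition whole :: "(bit \<Rightarrow> 'a::ab_group_add set) \<Rightarrow> 'a set" where
  "whole P = {x + y | x y. x \<in> P 0 \<and> y \<in> P 1}"

abbreviation carrier :: "('k, 'a::ab_group_add, 'm) super_alg_scheme \<Rightarrow> 'a set" where
  "carrier L \<equiv> whole (part L)"

definition component :: "(bit \<Rightarrow> 'a::ab_group_add set) \<Rightarrow> bit \<Rightarrow> 'a \<Rightarrow> 'a" where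
  "component P d x = (THE y. y \<in> P d \<and> x - y \<in> P (d + 1))"

text \<open>
  A zero entry may be given either degree; every identity below that is quantified over
  degrees holds trivially for it.
\<close>

definition homogeneous :: "(bit \<Rightarrow> 'a set) \<Rightarrow> bit list \<Rightarrow> 'a list \<Rightarrow> bool" where
  "homogeneous P ds xs \<longleftrightarrow> list_all2 (\<lambda>d x. x \<in> P d) ds xs"

definition graded_space :: "('k::field, 'a::ab_group_add) super_alg \<Rightarrow> bool" where
  "graded_space L \<longleftrightarrow> vector_space (scal L) \<and>
     (\<forall>d. module.subspace (scal L) (part L d)) \<and> part L 0 \<inter> part L 1 = {0}"

definition finite_dimensional :: "('k::field, 'a::ab_group_add) super_alg \<Rightarrow> bool" where
  "finite_dimensional L \<longleftrightarrow> (\<exists>S. finite S \<and> module.span (scal L) S = carrier L)"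

definition linear_map_on ::
    "'a::ab_group_add set \<Rightarrow> ('k \<Rightarrow> 'a \<Rightarrow> 'a) \<Rightarrow> ('k \<Rightarrow> 'b::ab_group_add \<Rightarrow> 'b) \<Rightarrow> ('a \<Rightarrow> 'b) \<Rightarrow> bool" where
  "linear_map_on C s t F \<longleftrightarrow>
     (\<forall>x\<in>C. \<forall>y\<in>C. F (x + y) = F x + F y) \<and> (\<forall>c. \<forall>x\<in>C. F (s c x) = t c (F x))"

definition multilinear_on ::
    "nat \<Rightarrow> 'a::ab_group_add set \<Rightarrow> ('k \<Rightarrow> 'a \<Rightarrow> 'a) \<Rightarrow> ('k \<Rightarrow> 'b::ab_group_add \<Rightarrow> 'b)
       \<Rightarrow> ('a list \<Rightarrow> 'b) \<Rightarrow> bool" where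
  "multilinear_on n C s t F \<longleftrightarrow>
     (\<forall>xs i. length xs = n \<and> set xs \<subseteq> C \<and> i < n \<longrightarrow> linear_map_on C s t (\<lambda>x. F (xs[i := x])))"

definition super_skew ::
    "nat \<Rightarrow> (bit \<Rightarrow> 'a set) \<Rightarrow> ('k::field \<Rightarrow> 'b \<Rightarrow> 'b) \<Rightarrow> ('a list \<Rightarrow> 'b) \<Rightarrow> bool" where
  "super_skew n P t F \<longleftrightarrow>
     (\<forall>ds xs i. homogeneous P ds xs \<and> length xs = n \<and> Suc i < n \<longrightarrow>
        F xs = t (- sg (ds ! i * ds ! Suc i)) (F (xs[i := xs ! Suc i, Suc i := xs ! i])))"


section \<open>First-class \<open>n\<close>-Lie superalgebras\<close>

definition n_lie_superalgebra :: "nat \<Rightarrow> ('k::field, 'a::ab_group_add) super_alg \<Rightarrow> bool" where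
  "n_lie_superalgebra n L \<longleftrightarrow>
     graded_space L \<and>
     multilinear_on n (carrier L) (scal L) (scal L) (brk L) \<and>
     (\<forall>ds xs. homogeneous (part L) ds xs \<and> length xs = n \<longrightarrow> brk L xs \<in> part L (sum_list ds)) \<and>
     super_skew n (part L) (scal L) (brk L) \<and>
     (\<forall>ds xs es ys. homogeneous (part L) ds xs \<and> length xs = n - 1 \<and>
        homogeneous (part L) es ys \<and> length ys = n \<longrightarrow>
        brk L (xs @ [brk L ys]) =
          (\<Sum>i<n. scal L (sg (sum_list ds * sum_list (take i es))) (brk L (ys[i := brk L (xs @ [ys ! i])]))))"

fun lower_central :: "nat \<Rightarrow> ('k::field, 'a::ab_group_add) super_alg \<Rightarrow> nat \<Rightarrow> 'a set" where
  "lower_central n L 0 = carrier L"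
| "lower_central n L (Suc m) = module.span (scal L)
     {brk L (x # xs) | x xs. x \<in> lower_central n L m \<and> set xs \<subseteq> carrier L \<and> length xs = n - 1}"

definition nilpotent :: "nat \<Rightarrow> ('k::field, 'a::ab_group_add) super_alg \<Rightarrow> bool" where
  "nilpotent n L \<longleftrightarrow> (\<exists>m. lower_central n L m = {0})"

definition nilpotent_length :: "nat \<Rightarrow> ('k::field, 'a::ab_group_add) super_alg \<Rightarrow> nat" where
  "nilpotent_length n L = (LEAST m. lower_central n L m = {0})"


section \<open>Metrics\<close>

definition bilinear_form ::
    "('k::field, 'a::ab_group_add) super_alg \<Rightarrow> ('a \<Rightarrow> 'a \<Rightarrow> 'k) \<Rightarrow> bool" where
  "bilinear_form L B \<longleftrightarrow>
     (\<forall>y\<in>carrier L. linear_map_on (carrier L) (scal L) (*) (\<lambda>x. B x y)) \<and>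
     (\<forall>x\<in>carrier L. linear_map_on (carrier L) (scal L) (*) (B x))"

definition consistent :: "('k::field, 'a) super_alg \<Rightarrow> ('a \<Rightarrow> 'a \<Rightarrow> 'k) \<Rightarrow> bool" where
  "consistent L B \<longleftrightarrow> (\<forall>d e. \<forall>x\<in>part L d. \<forall>y\<in>part L e. d \<noteq> e \<longrightarrow> B x y = 0)"

definition nondegenerate :: "('k::field, 'a::ab_group_add) super_alg \<Rightarrow> ('a \<Rightarrow> 'a \<Rightarrow> 'k) \<Rightarrow> bool" where
  "nondegenerate L B \<longleftrightarrow> {x \<in> carrier L. \<forall>y\<in>carrier L. B x y = 0} = {0}"

definition invariant ::
    "nat \<Rightarrow> ('k::field, 'a) super_alg \<Rightarrow> ('a \<Rightarrow> 'a \<Rightarrow> 'k) \<Rightarrow> bool" where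
  "invariant n L B \<longleftrightarrow>
     (\<forall>ds xs d y e z. homogeneous (part L) ds xs \<and> length xs = n - 1 \<and> y \<in> part L d \<and> z \<in> part L e \<longrightarrow>
        B (brk L (xs @ [y])) z = - sg (sum_list ds * d) * B y (brk L (xs @ [z])))"

definition supersymmetric :: "('k::field, 'a) super_alg \<Rightarrow> ('a \<Rightarrow> 'a \<Rightarrow> 'k) \<Rightarrow> bool" where
  "supersymmetric L B \<longleftrightarrow> (\<forall>d e. \<forall>x\<in>part L d. \<forall>y\<in>part L e. B x y = sg (d * e) * B y x)"

definition is_metric ::
    "nat \<Rightarrow> ('k::field, 'a::ab_group_add) super_alg \<Rightarrow> ('a \<Rightarrow> 'a \<Rightarrow> 'k) \<Rightarrow> bool" where
  "is_metric n L B \<longleftrightarrow> bilinear_form L B \<and> consistent L B \<and>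
     nondegenerate L B \<and> invariant n L B \<and> supersymmetric L B"

definition isometric ::
    "nat \<Rightarrow> ('k::field, 'a::ab_group_add) super_alg \<Rightarrow> ('a \<Rightarrow> 'a \<Rightarrow> 'k)
       \<Rightarrow> ('k, 'b::ab_group_add) super_alg \<Rightarrow> ('b \<Rightarrow> 'b \<Rightarrow> 'k) \<Rightarrow> bool" where
  "isometric n L B M D \<longleftrightarrow>
     (\<exists>\<phi>. bij_betw \<phi> (carrier L) (carrier M) \<and>
          linear_map_on (carrier L) (scal L) (scal M) \<phi> \<and>
          (\<forall>d. \<phi> ` part L d = part M d) \<and>
          (\<forall>xs. set xs \<subseteq> carrier L \<and> length xs = n \<longrightarrow> \<phi> (brk L xs) = brk M (map \<phi> xs)) \<and>
          (\<forall>x\<in>carrier L. \<forall>y\<in>carrier L. D (\<phi> x) (\<phi> y) = B x y))"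

definition restrict_to :: "('k, 'a) super_alg \<Rightarrow> 'a set \<Rightarrow> ('k, 'a) super_alg" where
  "restrict_to L I = L\<lparr>part := \<lambda>d. part L d \<inter> I\<rparr>"

definition graded_ideal :: "nat \<Rightarrow> ('k::field, 'a::ab_group_add) super_alg \<Rightarrow> 'a set \<Rightarrow> bool" where
  "graded_ideal n L I \<longleftrightarrow>
     module.subspace (scal L) I \<and> I = carrier (restrict_to L I) \<and>
     (\<forall>xs. set xs \<subseteq> carrier L \<and> length xs = n \<and> set xs \<inter> I \<noteq> {} \<longrightarrow> brk L xs \<in> I)"

definition nondegenerate_ideal ::
    "nat \<Rightarrow> ('k::field, 'a::ab_group_add) super_alg \<Rightarrow> ('a \<Rightarrow> 'a \<Rightarrow> 'k) \<Rightarrow> 'a set \<Rightarrow> bool" where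
  "nondegenerate_ideal n L B I \<longleftrightarrow> graded_ideal n L I \<and> nondegenerate (restrict_to L I) B"

definition codimension_one :: "('k::field, 'a::ab_group_add) super_alg \<Rightarrow> 'a set \<Rightarrow> bool" where
  "codimension_one L I \<longleftrightarrow> I \<subseteq> carrier L \<and>
     vector_space.dim (scal L) (carrier L) = vector_space.dim (scal L) I + 1"


section \<open>The coadjoint module and cocycles\<close>

definition fscale :: "'k::field \<Rightarrow> ('a \<Rightarrow> 'k) \<Rightarrow> 'a \<Rightarrow> 'k" where
  "fscale c f = (\<lambda>z. c * f z)"

text \<open>Linear forms on the carrier are represented by their extension by zero.\<close>

definition dual_part :: "('k::field, 'a::ab_group_add) super_alg \<Rightarrow> bit \<Rightarrow> ('a \<Rightarrow> 'k) set" where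
  "dual_part L d = {f. linear_map_on (carrier L) (scal L) (*) f \<and>
     (\<forall>z. z \<notin> carrier L \<longrightarrow> f z = 0) \<and> (\<forall>z\<in>part L (d + 1). f z = 0)}"

text \<open>
  \<open>coad L a xs e f\<close> is \<open>ad\<^sup>*(xs) f\<close> for homogeneous \<open>xs\<close> of total degree \<open>a\<close> and
  homogeneous \<open>f\<close> of degree \<open>e\<close>.
\<close>

definition coad ::
    "('k::field, 'a::ab_group_add) super_alg \<Rightarrow> bit \<Rightarrow> 'a list \<Rightarrow> bit \<Rightarrow> ('a \<Rightarrow> 'k) \<Rightarrow> 'a \<Rightarrow> 'k" where
  "coad L a xs e f = (\<lambda>z. if z \<in> carrier L then - sg (a * e) * f (brk L (xs @ [z])) else 0)"

definition omit :: "nat \<Rightarrow> 'b list \<Rightarrow> 'b list" where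
  "omit i xs = take i xs @ drop (Suc i) xs"

text \<open>
  \<open>mixed_brk L ds xs i f\<close> is the bracket of \<open>xs\<close> with the \<open>i\<close>-th entry (counted from 0,
  its value being ignored) replaced by the linear form \<open>f\<close>. The degrees of all entries,
  including \<open>f\<close>, are listed in \<open>ds\<close>; the sign comes from moving \<open>f\<close> to the last place.
\<close>

definition mixed_brk ::
    "('k::field, 'a::ab_group_add) super_alg \<Rightarrow> bit list \<Rightarrow> 'a list \<Rightarrow> nat \<Rightarrow> ('a \<Rightarrow> 'k) \<Rightarrow> 'a \<Rightarrow> 'k" where
  "mixed_brk L ds xs i f =
     fscale ((- 1) ^ (length xs - Suc i) * sg (ds ! i * sum_list (drop (Suc i) ds)))
       (coad L (sum_list (omit i ds)) (omit i xs) (ds ! i) f)"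

text \<open>
  \<open>delta L \<theta> ds xs es ys c z\<close> is \<open>\<delta>\<theta>(\<X>, \<Y>, z)\<close> for homogeneous \<open>\<X> = xs\<close>, \<open>\<Y> = ys\<close>, \<open>z\<close> of
  degrees \<open>ds\<close>, \<open>es\<close>, \<open>c\<close>; the first sum is \<open>\<theta>(\<X>\<cdot>\<Y>, z)\<close>.
\<close>

definition delta ::
    "('k::field, 'a::ab_group_add) super_alg \<Rightarrow> ('a list \<Rightarrow> 'a \<Rightarrow> 'k)
       \<Rightarrow> bit list \<Rightarrow> 'a list \<Rightarrow> bit list \<Rightarrow> 'a list \<Rightarrow> bit \<Rightarrow> 'a \<Rightarrow> 'a \<Rightarrow> 'k" where
  "delta L \<theta> ds xs es ys c z =
     (let a = sum_list ds; b = sum_list es in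
      - (\<Sum>i<length ys. fscale (sg (a * sum_list (take i es))) (\<theta> (ys[i := brk L (xs @ [ys ! i])] @ [z])))
      - fscale (sg (a * b)) (\<theta> (ys @ [brk L (xs @ [z])]))
      + \<theta> (xs @ [brk L (ys @ [z])])
      + coad L a xs (b + c) (\<theta> (ys @ [z]))
      - fscale (sg (a * b)) (coad L b ys (a + c) (\<theta> (xs @ [z])))
      - (\<Sum>i<length ys. fscale (sg (a * sum_list (take i es)))
           (mixed_brk L (es[i := a + es ! i] @ [c]) (ys @ [z]) i (\<theta> (xs @ [ys ! i])))))"

text \<open>The space \<open>Z\<^sup>1(L, L\<^sup>*)\<close> of cocycles of degree 0.\<close>

definition even_cocycles ::
    "nat \<Rightarrow> ('k::field, 'a::ab_group_add) super_alg \<Rightarrow> ('a list \<Rightarrow> 'a \<Rightarrow> 'k) set" where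
  "even_cocycles n L = {\<theta>.
     multilinear_on n (carrier L) (scal L) fscale \<theta> \<and>
     (\<forall>ds xs. homogeneous (part L) ds xs \<and> length xs = n \<longrightarrow> \<theta> xs \<in> dual_part L (sum_list ds)) \<and>
     super_skew n (part L) fscale \<theta> \<and>
     (\<forall>ds xs es ys c z. homogeneous (part L) ds xs \<and> length xs = n - 1 \<and>
        homogeneous (part L) es ys \<and> length ys = n - 1 \<and> z \<in> part L c \<longrightarrow>
        delta L \<theta> ds xs es ys c z = 0)}"

definition cyclic_condition ::
    "nat \<Rightarrow> ('k::field, 'a::ab_group_add) super_alg \<Rightarrow> ('a list \<Rightarrow> 'a \<Rightarrow> 'k) \<Rightarrow> bool" where
  "cyclic_condition n L \<theta> \<longleftrightarrow>
     (\<forall>ds xs d y e z. homogeneous (part L) ds xs \<and> length xs = n - 1 \<and> y \<in> part L d \<and> z \<in> part L e \<longrightarrow>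
        \<theta> (xs @ [y]) z + sg (d * e) * \<theta> (xs @ [z]) y = 0)"


section \<open>\<open>T\<^sup>*\<close>-extensions\<close>

text \<open>The element \<open>x + f\<close> of the direct sum of \<open>L\<close> and its dual is the pair \<open>(x, f)\<close>.\<close>

definition Tstar_scal ::
    "('k::field, 'a::ab_group_add) super_alg \<Rightarrow> 'k \<Rightarrow> 'a \<times> ('a \<Rightarrow> 'k) \<Rightarrow> 'a \<times> ('a \<Rightarrow> 'k)" where
  "Tstar_scal L c p = (scal L c (fst p), fscale c (snd p))"

definition Tstar_part ::
    "('k::field, 'a::ab_group_add) super_alg \<Rightarrow> bit \<Rightarrow> ('a \<times> ('a \<Rightarrow> 'k)) set" where
  "Tstar_part L d = part L d \<times> dual_part L d"

text \<open>The bracket of homogeneous \<open>ps\<close> of degrees \<open>ds\<close>.\<close>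

definition Tstar_brk_hom ::
    "('k::field, 'a::ab_group_add) super_alg \<Rightarrow> ('a list \<Rightarrow> 'a \<Rightarrow> 'k)
       \<Rightarrow> bit list \<Rightarrow> ('a \<times> ('a \<Rightarrow> 'k)) list \<Rightarrow> 'a \<times> ('a \<Rightarrow> 'k)" where
  "Tstar_brk_hom L \<theta> ds ps =
     (brk L (map fst ps),
      \<theta> (map fst ps) + (\<Sum>i<length ps. mixed_brk L ds (map fst ps) i (snd (ps ! i))))"

text \<open>
  Bracket and form are given on homogeneous elements; on arbitrary elements they are
  extended multilinearly by summing over all homogeneous components.
\<close>

definition Tstar ::
    "nat \<Rightarrow> ('k::field, 'a::ab_group_add) super_alg \<Rightarrow> ('a list \<Rightarrow> 'a \<Rightarrow> 'k)
       \<Rightarrow> ('k, 'a \<times> ('a \<Rightarrow> 'k)) super_alg" where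
  "Tstar n L \<theta> =
     \<lparr>scal = Tstar_scal L,
      part = Tstar_part L,
      brk = (\<lambda>ps. \<Sum>ds\<in>{ds. length ds = n}. Tstar_brk_hom L \<theta> ds (map2 (component (Tstar_part L)) ds ps))\<rparr>"

definition Tstar_form ::
    "('k::field, 'a::ab_group_add) super_alg \<Rightarrow> 'a \<times> ('a \<Rightarrow> 'k) \<Rightarrow> 'a \<times> ('a \<Rightarrow> 'k) \<Rightarrow> 'k" where
  "Tstar_form L p q =
     (\<Sum>d\<in>UNIV. \<Sum>e\<in>UNIV.
        let (x, f) = component (Tstar_part L) d p; (y, g) = component (Tstar_part L) e q
        in f y + sg (d * e) * g x)"

end

theory Submission
  imports Defs
begin

text \<open>
  Let \<open>L\<close> be a metric algebra of nilpotent length \<open>k\<close> and \<open>m = \<lceil>k / 2\<rceil>\<close>. Invariance moves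
  brackets from one argument of the form to the other, so the \<open>i\<close>-th and the \<open>j\<close>-th term of the
  lower central series are orthogonal once \<open>i + j \<ge> k\<close> (\<open>lc_orthogonal\<close>). Hence the \<open>m\<close>-th term
  is an isotropic ideal, and it is contained in a maximal graded isotropic ideal \<open>I\<close>. By
  maximality, a nonzero homogeneous vector of \<open>I\<^sup>\<bottom> / I\<close> that is annihilated by all brackets is
  anisotropic, hence even; two independent ones would combine to an isotropic one, and the
  orthogonal complement of one of them would by nilpotency contain another. So \<open>I\<^sup>\<bottom> / I\<close> is zero
  or a line, and brackets with \<open>I\<^sup>\<bottom>\<close> fall into \<open>I\<close> (\<open>perp_dichotomy\<close>, \<open>perp_central_mod\<close>).

  If \<open>I\<^sup>\<bottom> = I\<close>, one wants to split \<open>L\<close> into \<open>I\<close> and an isotropic complement, identify \<open>I\<close> with the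
  dual of the complement, and read off the cocycle; if \<open>I\<^sup>\<bottom> / I\<close> is a line, one wants to add one
  dimension first. Both cases are covered by an even endomorphism \<open>\<sigma>\<close> of \<open>L\<close> that
  vanishes on \<open>I\<close> and has the adjoint \<open>\<tau> = 1 - \<sigma>\<close>. In the first case it is the projection onto an
  isotropic complement, in the second it also halves the line \<open>I\<^sup>\<bottom> / I\<close>. It comes from an
  arbitrary complement: if \<open>p\<close> is any graded projection with kernel \<open>I\<close> and \<open>q\<close> its adjoint, then
  \<open>(1 + p - q) / 2\<close> is such a map (\<open>half_splitting_exists\<close>).

  Given \<open>\<sigma>\<close>, let the quotient of \<open>L\<close> by the kernel of \<open>\<sigma>\<close> be realised on the image of \<open>\<sigma>\<close>, with
  bracket \<open>\<sigma>[x\<^sub>1, \<dots>, x\<^sub>n]\<close> and cocycle \<open>\<langle>[x\<^sub>1, \<dots>, x\<^sub>n], \<cdot>\<rangle>\<close>, and send \<open>x\<close> to the pair of \<open>\<sigma> x\<close> and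
  the functional \<open>\<langle>x, \<cdot>\<rangle>\<close>. This map is isometric because \<open>\<sigma> + \<tau> = 1\<close>. The coadjoint action on
  \<open>\<langle>u, \<cdot>\<rangle>\<close> becomes a bracket with \<open>\<tau> u\<close> in \<open>L\<close> (\<open>coad_res\<close>, \<open>mixed_brk_res\<close>). Therefore the cocycle
  condition is the fundamental identity of \<open>L\<close> with every inner bracket split into its \<open>\<sigma>\<close>- and
  \<open>\<tau>\<close>-part (\<open>half_cocycle_delta\<close>), and the bracket of the extension is the expansion of
  \<open>[x\<^sub>1, \<dots>, x\<^sub>n]\<close> along \<open>x\<^sub>i = \<sigma> x\<^sub>i + \<tau> x\<^sub>i\<close>, in which terms with two \<open>\<tau>\<close>-entries vanish
  (\<open>brk_expand_\<sigma>\<tau>\<close>). The image contains all brackets of the extension, so it is an ideal. Its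
  codimension is the rank of \<open>\<sigma> \<circ> \<tau>\<close>, which is zero if \<open>I\<^sup>\<bottom> = I\<close> and one otherwise. As \<open>\<sigma>\<close> kills
  the \<open>m\<close>-th term of the lower central series, the quotient has nilpotent length at most \<open>m\<close>.
\<close>

(* Degrees are added and multiplied as elements of a field, not as bit patterns. *)
lemmas [simp del] = add_bit_eq_xor mult_bit_eq_and

section \<open>Signs and graded vector spaces\<close>

lemma bit_cases: "(d::bit) = 0 \<or> d = 1"
  by (cases d) auto

lemma bit_neq_iff: "(d::bit) \<noteq> e \<longleftrightarrow> e = d + 1"
  using bit_cases[of d] bit_cases[of e] by auto

lemma UNIV_bit: "(UNIV :: bit set) = {0, 1}"
  using bit_cases by auto

lemma sg_0 [simp]: "sg 0 = 1"
  by (simp add: sg_def)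

lemma sg_1: "sg 1 = - 1"
  by (simp add: sg_def)

lemma sg_add: "sg (a + b) = sg a * (sg b :: 'k::field)"
  using bit_cases[of a] bit_cases[of b] by (auto simp: sg_def)

lemma sg_square [simp]: "sg a * sg a = (1 :: 'k::field)" "sg a * (sg a * x) = (x :: 'k)"
  by (auto simp: sg_def)

locale graded_vector_space =
  fixes L :: "('k::field, 'a::ab_group_add) super_alg"
  assumes graded: "graded_space L"
begin

sublocale vector_space "scal L"
  using graded by (simp add: graded_space_def)

abbreviation comp :: "bit \<Rightarrow> 'a \<Rightarrow> 'a" where
  "comp \<equiv> component (part L)"

lemma subspace_part: "subspace (part L d)"
  using graded by (simp add: graded_space_def)

lemma part_disjoint: "x \<in> part L d \<Longrightarrow> x \<in> part L (d + 1) \<Longrightarrow> x = 0"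
  using graded bit_cases[of d] by (auto simp: graded_space_def)

lemma zero_part [simp]: "0 \<in> part L d"
  by (rule subspace_0[OF subspace_part])

lemma subspace_carrier: "subspace (carrier L)"
  unfolding whole_def using subspace_sums[OF subspace_part subspace_part] by simp

lemmas carrier_closed [simp, intro] =
  subspace_0[OF subspace_carrier] subspace_add[OF subspace_carrier]
  subspace_scale[OF subspace_carrier] subspace_diff[OF subspace_carrier]
  subspace_neg[OF subspace_carrier] subspace_sum[OF subspace_carrier]

lemma part_carrier: "x \<in> part L d \<Longrightarrow> x \<in> carrier L"
  using bit_cases[of d] unfolding whole_def
  by (auto intro: exI[of _ x] exI[of _ 0])

lemma component_unique:
  assumes "y \<in> part L d" "x - y \<in> part L (d + 1)"
  shows "comp d x = y"
  unfolding component_def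
proof (rule the_equality)
  fix z assume z: "z \<in> part L d \<and> x - z \<in> part L (d + 1)"
  have "z - y = (x - y) - (x - z)" by simp
  with assms z have "z - y \<in> part L (d + 1)" "z - y \<in> part L d"
    by (metis subspace_diff[OF subspace_part])+
  then show "z = y" using part_disjoint by fastforce
qed (use assms in auto)

lemma component_part: "x \<in> carrier L \<Longrightarrow> comp d x \<in> part L d"
  and minus_component_part: "x \<in> carrier L \<Longrightarrow> x - comp d x \<in> part L (d + 1)"
proof -
  assume "x \<in> carrier L"
  then obtain y z where yz: "y \<in> part L 0" "z \<in> part L 1" "x = y + z"
    unfolding whole_def by auto
  have "comp d x = (if d = 0 then y else z)"
    by (rule component_unique) (use yz bit_cases[of d] in auto)
  then show "comp d x \<in> part L d" "x - comp d x \<in> part L (d + 1)"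
    using yz bit_cases[of d] by auto
qed

lemma component_carrier [simp, intro]: "x \<in> carrier L \<Longrightarrow> comp d x \<in> carrier L"
  using component_part part_carrier by blast

lemma component_same: "x \<in> part L d \<Longrightarrow> comp d x = x"
  by (rule component_unique) auto

lemma component_other: "x \<in> part L d \<Longrightarrow> d \<noteq> e \<Longrightarrow> comp e x = 0"
  by (rule component_unique) (auto simp: bit_neq_iff)

lemma component_add:
  "x \<in> carrier L \<Longrightarrow> y \<in> carrier L \<Longrightarrow> comp d (x + y) = comp d x + comp d y"
  by (rule component_unique)
    (auto simp: component_part subspace_add[OF subspace_part] add_diff_add minus_component_part)

lemma component_scale: "x \<in> carrier L \<Longrightarrow> comp d (scal L c x) = scal L c (comp d x)"
  by (rule component_unique)
    (auto simp: component_part subspace_scale[OF subspace_part] minus_component_part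
      simp flip: scale_right_diff_distrib)

lemma component_split: "x \<in> carrier L \<Longrightarrow> x = comp 0 x + comp 1 x"
proof -
  assume x: "x \<in> carrier L"
  have "comp 1 x = x - comp 0 x"
    by (rule component_unique)
      (use minus_component_part[OF x, of 0] component_part[OF x, of 0] in auto)
  then show ?thesis by simp
qed

lemma component_sum: "x \<in> carrier L \<Longrightarrow> (\<Sum>d\<in>UNIV. comp d x) = x"
  using component_split[of x] by (simp add: UNIV_bit)

definition graded_subset :: "'a set \<Rightarrow> bool" where
  "graded_subset X \<longleftrightarrow> X \<subseteq> carrier L \<and> (\<forall>x\<in>X. \<forall>d. comp d x \<in> X)"

lemma graded_subsetD:
  "graded_subset X \<Longrightarrow> x \<in> X \<Longrightarrow> x \<in> carrier L"
  "graded_subset X \<Longrightarrow> x \<in> X \<Longrightarrow> comp d x \<in> X"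
  by (auto simp: graded_subset_def)

lemma graded_subset_part: "x \<in> part L d \<Longrightarrow> x \<in> X \<Longrightarrow> 0 \<in> X \<Longrightarrow> comp e x \<in> X"
  by (cases "d = e") (auto simp: component_same component_other)

lemma graded_subset_span:
  assumes "\<And>x. x \<in> A \<Longrightarrow> x \<in> carrier L" "\<And>x d. x \<in> A \<Longrightarrow> comp d x \<in> span A"
  shows "graded_subset (span A)"
proof -
  have sub: "span A \<subseteq> carrier L"
    by (rule span_minimal) (use assms subspace_carrier in auto)
  have "comp d x \<in> span A" if "x \<in> span A" for x d
  proof -
    have "x \<in> carrier L \<and> comp d x \<in> span A"
      using that
    proof (induction rule: span_induct_alt)
      case base
      then show ?case by (simp add: component_same span_zero)
    next
      case (step c x y)
      with assms show ?case
        by (auto simp: component_add component_scale intro!: span_add span_scale)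
    qed
    then show ?thesis by simp
  qed
  with sub show ?thesis by (auto simp: graded_subset_def)
qed

definition even_map :: "('a \<Rightarrow> 'a) \<Rightarrow> bool" where
  "even_map f \<longleftrightarrow> linear_map_on (carrier L) (scal L) (scal L) f \<and> (\<forall>d. \<forall>x\<in>part L d. f x \<in> part L d)"

lemma even_mapD:
  assumes "even_map f"
  shows "x \<in> carrier L \<Longrightarrow> y \<in> carrier L \<Longrightarrow> f (x + y) = f x + f y"
    and "x \<in> carrier L \<Longrightarrow> f (scal L c x) = scal L c (f x)"
    and "x \<in> part L d \<Longrightarrow> f x \<in> part L d"
  using assms by (auto simp: even_map_def linear_map_on_def)

lemma even_map_component:
  assumes f: "even_map f" and x: "x \<in> carrier L"
  shows "comp d (f x) = f (comp d x)"
proof (rule component_unique)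
  show "f (comp d x) \<in> part L d" by (rule even_mapD(3)[OF f component_part[OF x]])
  have "f (comp d x + (x - comp d x)) = f (comp d x) + f (x - comp d x)"
    using x by (intro even_mapD(1)[OF f]) auto
  then have "f x - f (comp d x) = f (x - comp d x)" by simp
  then show "f x - f (comp d x) \<in> part L (d + 1)"
    using even_mapD(3)[OF f minus_component_part[OF x]] by simp
qed

lemma even_map_carrier: "even_map f \<Longrightarrow> x \<in> carrier L \<Longrightarrow> f x \<in> carrier L"
  using even_mapD(1)[of f "comp 0 x" "comp 1 x"] component_split[of x] component_part[of x]
    even_mapD(3)[of f, THEN part_carrier] by (metis carrier_closed(2) component_carrier)

end

section \<open>Multilinear maps\<close>

lemma homogeneous_nth: "homogeneous P ds xs \<Longrightarrow> i < length xs \<Longrightarrow> xs ! i \<in> P (ds ! i)"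
  by (auto simp: homogeneous_def list_all2_conv_all_nth)

lemma homogeneous_length: "homogeneous P ds xs \<Longrightarrow> length ds = length xs"
  by (auto simp: homogeneous_def list_all2_lengthD)

lemma homogeneousI:
  "length ds = length xs \<Longrightarrow> (\<And>i. i < length xs \<Longrightarrow> xs ! i \<in> P (ds ! i)) \<Longrightarrow> homogeneous P ds xs"
  by (auto simp: homogeneous_def list_all2_conv_all_nth)

lemma homogeneous_append:
  "length ds = length xs \<Longrightarrow>
   homogeneous P (ds @ es) (xs @ ys) \<longleftrightarrow> homogeneous P ds xs \<and> homogeneous P es ys"
  by (auto simp: homogeneous_def list_all2_append)

lemma homogeneous_appendI:
  "homogeneous P ds xs \<Longrightarrow> homogeneous P es ys \<Longrightarrow> homogeneous P (ds @ es) (xs @ ys)"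
  by (simp add: homogeneous_append homogeneous_length)

lemma homogeneous_Nil [simp]: "homogeneous P [] []"
  by (auto simp: homogeneous_def)

lemma homogeneous_Cons [simp]:
  "homogeneous P (d # ds) (x # xs) \<longleftrightarrow> x \<in> P d \<and> homogeneous P ds xs"
  by (auto simp: homogeneous_def)

lemma homogeneous_update:
  "homogeneous P ds xs \<Longrightarrow> x \<in> P d \<Longrightarrow> homogeneous P (ds[i := d]) (xs[i := x])"
  by (auto simp: homogeneous_def intro: list_all2_update_cong)

lemma homogeneous_omit: "homogeneous P ds xs \<Longrightarrow> homogeneous P (omit i ds) (omit i xs)"
  by (auto simp: omit_def homogeneous_def intro!: list_all2_appendI)

lemma homogeneous_mono:
  "homogeneous P ds xs \<Longrightarrow> (\<And>d. P d \<subseteq> Q d) \<Longrightarrow> homogeneous Q ds xs"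
  by (auto simp: homogeneous_def elim!: list_all2_mono)

lemma homogeneous_map:
  "homogeneous P ds xs \<Longrightarrow> (\<And>d x. x \<in> P d \<Longrightarrow> f x \<in> Q d) \<Longrightarrow> homogeneous Q ds (map f xs)"
  by (auto simp: homogeneous_def list_all2_map2 elim!: list_all2_mono)

lemma (in graded_vector_space) homogeneous_carrier:
  "homogeneous (part L) ds xs \<Longrightarrow> set xs \<subseteq> carrier L"
  by (auto simp: homogeneous_def list_all2_conv_all_nth in_set_conv_nth) (metis part_carrier)

lemma (in graded_vector_space) homogeneous_components:
  "set xs \<subseteq> carrier L \<Longrightarrow> length ds = length xs \<Longrightarrow> homogeneous (part L) ds (map2 comp ds xs)"
  by (rule homogeneousI) (auto simp: component_part subset_iff)

lemma multilinear_onD: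
  assumes "multilinear_on n C s t F" "length pre + Suc (length post) = n"
    "set pre \<subseteq> C" "set post \<subseteq> C"
  shows "x \<in> C \<Longrightarrow> y \<in> C \<Longrightarrow> F (pre @ (x + y) # post) = F (pre @ x # post) + F (pre @ y # post)"
    and "x \<in> C \<Longrightarrow> F (pre @ s c x # post) = t c (F (pre @ x # post))"
proof -
  have "linear_map_on C s t (\<lambda>z. F ((pre @ x # post)[length pre := z]))" if "x \<in> C" for x
    using assms(1)[unfolded multilinear_on_def, rule_format, of "pre @ x # post" "length pre"] assms(2-) that
    by simp
  then show "x \<in> C \<Longrightarrow> y \<in> C \<Longrightarrow> F (pre @ (x + y) # post) = F (pre @ x # post) + F (pre @ y # post)"
    and "x \<in> C \<Longrightarrow> F (pre @ s c x # post) = t c (F (pre @ x # post))"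
    by (auto simp: linear_map_on_def)
qed

lemma lists_Suc_sum:
  "(\<Sum>ds\<in>{ds :: bit list. length ds = Suc m}. G ds) =
   (\<Sum>d\<in>UNIV. \<Sum>ds\<in>{ds. length ds = m}. G (d # ds))"
proof -
  have "{ds :: bit list. length ds = Suc m} = (\<lambda>(d, ds). d # ds) ` (UNIV \<times> {ds. length ds = m})"
    by (auto simp: length_Suc_conv image_iff)
  moreover have "inj_on (\<lambda>(d, ds). d # ds) (UNIV \<times> {ds :: bit list. length ds = m})"
    by (auto simp: inj_on_def)
  ultimately show ?thesis
    by (simp add: sum.reindex sum.cartesian_product split_def)
qed

context graded_vector_space
begin

text \<open>
  The axioms of a superalgebra only speak about homogeneous entries; this expansion is how they
  are used for arbitrary ones.
\<close>

lemma multilinear_expand: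
  assumes "multilinear_on n (carrier L) (scal L) t F" "set xs \<subseteq> carrier L" "length xs = n"
  shows "F xs = (\<Sum>ds\<in>{ds. length ds = n}. F (map2 comp ds xs))"
proof -
  have "F (pre @ xs) = (\<Sum>ds\<in>{ds. length ds = length xs}. F (pre @ map2 comp ds xs))"
    if "set pre \<subseteq> carrier L" "set xs \<subseteq> carrier L" "length pre + length xs = n" for pre xs
    using that
  proof (induction xs arbitrary: pre)
    case Nil
    then show ?case by simp
  next
    case (Cons x xs)
    have "F (pre @ x # xs) = (\<Sum>d\<in>UNIV. F (pre @ comp d x # xs))"
      using Cons.prems component_split[of x] multilinear_onD(1)[OF assms(1), of pre xs "comp 0 x" "comp 1 x"]
      by (simp add: UNIV_bit)
    also have "\<dots> = (\<Sum>d\<in>UNIV. F ((pre @ [comp d x]) @ xs))"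
      by simp
    also have "\<dots> = (\<Sum>d\<in>UNIV. \<Sum>ds\<in>{ds. length ds = length xs}. F ((pre @ [comp d x]) @ map2 comp ds xs))"
      using Cons.prems by (intro sum.cong refl Cons.IH) auto
    finally show ?case by (simp add: lists_Suc_sum)
  qed
  from this[of "[]" xs] assms show ?thesis by simp
qed

end

lemma omit_append [simp]: "length xs = i \<Longrightarrow> omit i (xs @ y # ys) = xs @ ys"
  by (auto simp: omit_def)

lemma map2_member:
  assumes "x \<in> set xs" "length ds = length xs"
  shows "\<exists>d. f d x \<in> set (map2 f ds xs)"
proof -
  obtain i where i: "i < length xs" "xs ! i = x" using assms(1) by (auto simp: in_set_conv_nth)
  then have "map2 f ds xs ! i = f (ds ! i) x" "i < length (map2 f ds xs)" using assms(2) by auto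
  then show ?thesis by (metis nth_mem)
qed

lemma omit_swap:
  assumes "Suc i < length xs"
  shows "omit (Suc i) (xs[i := xs ! Suc i, Suc i := xs ! i]) = omit i xs"
proof (rule nth_equalityI)
  show "length (omit (Suc i) (xs[i := xs ! Suc i, Suc i := xs ! i])) = length (omit i xs)"
    using assms by (simp add: omit_def)
  fix j assume "j < length (omit (Suc i) (xs[i := xs ! Suc i, Suc i := xs ! i]))"
  then show "omit (Suc i) (xs[i := xs ! Suc i, Suc i := xs ! i]) ! j = omit i xs ! j"
    using assms
    by (cases "j = i") (auto simp: omit_def nth_append nth_list_update min_def Suc_diff_le)
qed

text \<open>
  Each transposition on the way to the last place contributes its own sign, and the degrees of
  the entries that are passed add up because \<open>sg\<close> turns sums into products. The resulting sign
  is the one in the definition of \<open>mixed_brk\<close>.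
\<close>

lemma super_skew_move_last:
  assumes F: "super_skew n P t F" and t: "\<And>a b x. t a (t b x) = t (a * b) x" "\<And>x. t 1 x = x"
    and hom: "homogeneous P ds xs" "length xs = n" "i < n"
  shows "F xs = t ((- 1) ^ (n - Suc i) * sg (ds ! i * sum_list (drop (Suc i) ds)))
                   (F (omit i xs @ [xs ! i]))"
  using hom
proof (induction "n - Suc i" arbitrary: i ds xs)
  case 0
  then have i: "Suc i = n" by simp
  have "omit i xs @ [xs ! i] = xs"
    using 0 i by (simp add: omit_def) (metis lessI take_Suc_conv_app_nth take_all order_refl)
  then show ?case
    using 0 i homogeneous_length[OF 0(2)] by (simp add: t)
next
  case (Suc m)
  let ?xs = "xs[i := xs ! Suc i, Suc i := xs ! i]" and ?ds = "ds[i := ds ! Suc i, Suc i := ds ! i]"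
  have len: "length ds = n" and i: "Suc i < n"
    using Suc homogeneous_length[OF Suc(3)] by auto
  have hom': "homogeneous P ?ds ?xs"
    using Suc(3,4) i len by (intro homogeneous_update homogeneous_nth) auto
  have "F xs = t (- sg (ds ! i * ds ! Suc i)) (F ?xs)"
    using F Suc(3,4) i unfolding super_skew_def by blast
  also have "F ?xs = t ((- 1) ^ (n - Suc (Suc i)) * sg (ds ! i * sum_list (drop (Suc (Suc i)) ds)))
                       (F (omit i xs @ [xs ! i]))"
    using Suc(1)[of "Suc i" ?ds ?xs] Suc(2,4) i len hom' by (simp add: omit_swap)
  also have "n - Suc i = Suc (n - Suc (Suc i))" using i by simp
  moreover have "sum_list (drop (Suc i) ds) = ds ! Suc i + sum_list (drop (Suc (Suc i)) ds)"
    using i len by (metis Cons_nth_drop_Suc sum_list.Cons)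
  ultimately show ?case
    by (simp add: t distrib_left sg_add mult_ac)
qed

section \<open>Brackets and the lower central series\<close>

locale n_lie_space =
  fixes n :: nat and L :: "('k::field, 'a::ab_group_add) super_alg"
  assumes n_pos: "n \<ge> 1" and n_lie: "n_lie_superalgebra n L"

sublocale n_lie_space \<subseteq> graded_vector_space L
  by standard (use n_lie in \<open>simp add: n_lie_superalgebra_def\<close>)

context n_lie_space
begin

lemma brk_multilinear: "multilinear_on n (carrier L) (scal L) (scal L) (brk L)"
  using n_lie by (simp add: n_lie_superalgebra_def)

lemma brk_part: "homogeneous (part L) ds xs \<Longrightarrow> length xs = n \<Longrightarrow> brk L xs \<in> part L (sum_list ds)"
  using n_lie by (simp add: n_lie_superalgebra_def)

lemma brk_skew: "super_skew n (part L) (scal L) (brk L)"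
  using n_lie by (simp add: n_lie_superalgebra_def)

lemma brk_leibniz:
  "homogeneous (part L) ds xs \<Longrightarrow> length xs = n - 1 \<Longrightarrow> homogeneous (part L) es ys \<Longrightarrow> length ys = n \<Longrightarrow>
     brk L (xs @ [brk L ys]) =
       (\<Sum>i<n. scal L (sg (sum_list ds * sum_list (take i es))) (brk L (ys[i := brk L (xs @ [ys ! i])])))"
  using n_lie by (simp add: n_lie_superalgebra_def)

lemma brk_expand:
  "set xs \<subseteq> carrier L \<Longrightarrow> length xs = n \<Longrightarrow> brk L xs = (\<Sum>ds\<in>{ds. length ds = n}. brk L (map2 comp ds xs))"
  by (rule multilinear_expand[OF brk_multilinear])

lemma brk_induct_homogeneous:
  assumes "set xs \<subseteq> carrier L" "length xs = n" "subspace X"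
    "\<And>ds. length ds = n \<Longrightarrow> brk L (map2 comp ds xs) \<in> X"
  shows "brk L xs \<in> X"
  unfolding brk_expand[OF assms(1,2)] by (rule subspace_sum) (use assms in auto)

lemma brk_carrier [simp, intro]: "set xs \<subseteq> carrier L \<Longrightarrow> length xs = n \<Longrightarrow> brk L xs \<in> carrier L"
  by (rule brk_induct_homogeneous)
    (auto intro!: subspace_carrier part_carrier[OF brk_part] homogeneous_components)

lemma brk_carrier_last [simp, intro]:
  "set xs \<subseteq> carrier L \<Longrightarrow> length xs = n - 1 \<Longrightarrow> x \<in> carrier L \<Longrightarrow> brk L (xs @ [x]) \<in> carrier L"
  using n_pos by auto

lemma brk_part_last:
  "homogeneous (part L) ds xs \<Longrightarrow> length xs = n - 1 \<Longrightarrow> x \<in> part L d \<Longrightarrow>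
     brk L (xs @ [x]) \<in> part L (sum_list ds + d)"
  using brk_part[of "ds @ [d]" "xs @ [x]"] homogeneous_appendI[of "part L" ds xs "[d]" "[x]"] n_pos
  by simp

lemma brk_move_last:
  assumes "homogeneous (part L) ds xs" "length xs = n" "i < n"
  shows "brk L xs = scal L ((- 1) ^ (n - Suc i) * sg (ds ! i * sum_list (drop (Suc i) ds)))
                      (brk L (omit i xs @ [xs ! i]))"
  by (rule super_skew_move_last[OF brk_skew _ _ assms]) auto

lemma sign_square: "((- 1) ^ k * sg a) * ((- 1) ^ k * sg a) = (1::'k)"
  by (simp add: mult.assoc mult.left_commute[of "sg a"] flip: power_mult_distrib)

lemma omit_in: "set (omit i xs) \<subseteq> set xs"
  by (auto simp: omit_def dest: in_set_takeD in_set_dropD)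

lemma length_omit [simp]: "i < length xs \<Longrightarrow> length (omit i xs) = length xs - 1"
  by (simp add: omit_def)

text \<open>
  A bracket is multilinear, so it can be tested on the homogeneous components of its
  entries; for those, super-skew-symmetry moves any entry to the last place.
\<close>

lemma brk_mem_any_position:
  assumes Y: "graded_subset Y" and X: "subspace X"
    and closed: "\<And>xs y. set xs \<subseteq> carrier L \<Longrightarrow> length xs = n - 1 \<Longrightarrow> y \<in> Y \<Longrightarrow> brk L (xs @ [y]) \<in> X"
    and xs: "set xs \<subseteq> carrier L" "length xs = n" "i < n" "xs ! i \<in> Y"
  shows "brk L xs \<in> X"
proof (rule brk_induct_homogeneous[OF xs(1,2) X])
  fix ds :: "bit list" assume ds: "length ds = n"
  let ?ps = "map2 comp ds xs"
  have hom: "homogeneous (part L) ds ?ps" "length ?ps = n"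
    using ds xs by (auto intro: homogeneous_components)
  have "brk L (omit i ?ps @ [?ps ! i]) \<in> X"
  proof (rule closed)
    show "set (omit i ?ps) \<subseteq> carrier L"
      using omit_in homogeneous_carrier[OF hom(1)] by (rule subset_trans)
    show "length (omit i ?ps) = n - 1" using hom xs by simp
    show "?ps ! i \<in> Y" using xs ds Y by (simp add: graded_subsetD)
  qed
  then show "brk L ?ps \<in> X"
    using brk_move_last[OF hom xs(3)] by (simp add: subspace_scale[OF X])
qed

abbreviation lc :: "nat \<Rightarrow> 'a set" where
  "lc \<equiv> lower_central n L"

lemma lc_subspace: "subspace (lc m)"
  by (cases m) (auto intro: subspace_carrier)

lemma lc_graded: "graded_subset (lc m)"
proof (induction m)
  case 0
  then show ?case by (auto simp: graded_subset_def)
next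
  case (Suc m)
  let ?A = "{brk L (x # xs) | x xs. x \<in> lc m \<and> set xs \<subseteq> carrier L \<and> length xs = n - 1}"
  have sub: "lc m \<subseteq> carrier L" using Suc by (auto simp: graded_subset_def)
  have "comp d (brk L (x # xs)) \<in> span ?A"
    if x: "x \<in> lc m" "set xs \<subseteq> carrier L" "length xs = n - 1" for x xs d
  proof -
    have "brk L (x # xs) \<in> {y \<in> carrier L. comp d y \<in> span ?A}"
    proof (rule brk_induct_homogeneous)
      show "set (x # xs) \<subseteq> carrier L" "length (x # xs) = n" using x sub n_pos by auto
      show "subspace {y \<in> carrier L. comp d y \<in> span ?A}"
        by (rule subspaceI)
          (auto simp: component_same span_zero component_add component_scale span_add span_scale)
      fix ds :: "bit list" assume ds: "length ds = n"
      then obtain e es where es: "ds = e # es" "length es = n - 1"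
        using n_pos by (cases ds) auto
      have hom: "homogeneous (part L) ds (map2 comp ds (x # xs))"
        using x sub ds n_pos by (intro homogeneous_components) auto
      have "brk L (map2 comp ds (x # xs)) \<in> part L (sum_list ds)"
        by (rule brk_part[OF hom]) (use ds x n_pos in simp)
      moreover have "brk L (map2 comp ds (x # xs)) \<in> ?A"
      proof -
        have "set (map2 comp es xs) \<subseteq> carrier L" "length (map2 comp es xs) = n - 1"
          using homogeneous_carrier[OF hom] es x by auto
        moreover have "comp e x \<in> lc m" using Suc x by (simp add: graded_subsetD)
        moreover have "brk L (z # zs) \<in> ?A" if "z \<in> lc m" "set zs \<subseteq> carrier L" "length zs = n - 1" for z zs
          using that by blast
        ultimately show ?thesis using es by simp
      qed
      ultimately show "brk L (map2 comp ds (x # xs)) \<in> {y \<in> carrier L. comp d y \<in> span ?A}"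
        by (auto intro: part_carrier graded_subset_part span_base span_zero)
    qed
    then show ?thesis by simp
  qed
  moreover have "?A \<subseteq> carrier L"
    using sub n_pos by auto
  ultimately show ?case
    unfolding lower_central.simps by (intro graded_subset_span) blast+
qed

lemma lc_carrier: "lc m \<subseteq> carrier L"
  using lc_graded by (simp add: graded_subset_def)

lemma lc_in_carrier: "x \<in> lc m \<Longrightarrow> x \<in> carrier L"
  using lc_carrier by auto

text \<open>
  The lower central series is defined with the deeper entry in the first place, whereas
  invariance of a form concerns the last one. Exchanging the two only costs a sign.
\<close>

lemma brk_lc:
  assumes "set xs \<subseteq> carrier L" "length xs = n - 1" "y \<in> lc m"
  shows "brk L (xs @ [y]) \<in> lc (Suc m)"
proof (rule brk_induct_homogeneous[OF _ _ lc_subspace])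
  show "set (xs @ [y]) \<subseteq> carrier L" "length (xs @ [y]) = n"
    using assms lc_carrier n_pos by auto
  fix ds :: "bit list" assume "length ds = n"
  then obtain es e where ds: "ds = es @ [e]" "length es = n - 1"
    using n_pos by (cases ds rule: rev_cases) auto
  let ?ps = "map2 comp es xs" and ?y = "comp e y"
  have hom: "homogeneous (part L) es ?ps" "length ?ps = n - 1"
    using assms ds by (auto intro: homogeneous_components)
  have y: "?y \<in> lc m" "?y \<in> part L e"
    using assms graded_subsetD[OF lc_graded] lc_carrier by (auto intro: component_part)
  have "brk L (?y # ?ps) = scal L ((- 1) ^ (n - 1) * sg (e * sum_list es)) (brk L (?ps @ [?y]))"
    using brk_move_last[of "e # es" "?y # ?ps" 0] hom y n_pos by (simp add: omit_def)
  then have "brk L (?ps @ [?y]) = scal L ((- 1) ^ (n - 1) * sg (e * sum_list es)) (brk L (?y # ?ps))"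
    by (simp only: scale_scale sign_square scale_one)
  moreover have "brk L (?y # ?ps) \<in> lc (Suc m)"
    using y hom by (auto intro!: span_base exI dest: homogeneous_carrier)
  ultimately show "brk L (map2 comp ds (xs @ [y])) \<in> lc (Suc m)"
    using ds assms by (simp add: subspace_scale[OF lc_subspace] del: lower_central.simps)
qed

lemma lc_Suc_subset: "lc (Suc m) \<subseteq> lc m"
proof (induction m)
  case 0
  then show ?case using lc_carrier[of "Suc 0"] by simp
next
  case (Suc m)
  have "{brk L (x # xs) | x xs. x \<in> lc (Suc m) \<and> set xs \<subseteq> carrier L \<and> length xs = n - 1}
     \<subseteq> {brk L (x # xs) | x xs. x \<in> lc m \<and> set xs \<subseteq> carrier L \<and> length xs = n - 1}"
    using Suc by blast
  then show ?case
    unfolding lower_central.simps(2)[of n L "Suc m"] lower_central.simps(2)[of n L m] by (rule span_mono)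
qed

lemma lc_antimono: "i \<le> j \<Longrightarrow> lc j \<subseteq> lc i"
  using lift_Suc_antimono_le[of lc i j, OF lc_Suc_subset] by auto

end

section \<open>Metrics\<close>

locale metric_n_lie_space = n_lie_space n L
  for n and L :: "('k::field, 'a::ab_group_add) super_alg" +
  fixes B :: "'a \<Rightarrow> 'a \<Rightarrow> 'k"
  assumes metric: "is_metric n L B"
begin

lemma B_add_left: "x \<in> carrier L \<Longrightarrow> y \<in> carrier L \<Longrightarrow> z \<in> carrier L \<Longrightarrow> B (x + y) z = B x z + B y z"
  and B_add_right: "x \<in> carrier L \<Longrightarrow> y \<in> carrier L \<Longrightarrow> z \<in> carrier L \<Longrightarrow> B z (x + y) = B z x + B z y"
  and B_scale_left: "x \<in> carrier L \<Longrightarrow> z \<in> carrier L \<Longrightarrow> B (scal L c x) z = c * B x z"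
  and B_scale_right: "x \<in> carrier L \<Longrightarrow> z \<in> carrier L \<Longrightarrow> B z (scal L c x) = c * B z x"
  using metric by (auto simp: is_metric_def bilinear_form_def linear_map_on_def)

lemma B_zero_left [simp]: "z \<in> carrier L \<Longrightarrow> B 0 z = 0"
  and B_zero_right [simp]: "z \<in> carrier L \<Longrightarrow> B z 0 = 0"
  using B_scale_left[of 0 z 0] B_scale_right[of 0 z 0] by auto

lemma B_diff_left: "x \<in> carrier L \<Longrightarrow> y \<in> carrier L \<Longrightarrow> z \<in> carrier L \<Longrightarrow> B (x - y) z = B x z - B y z"
  and B_diff_right: "x \<in> carrier L \<Longrightarrow> y \<in> carrier L \<Longrightarrow> z \<in> carrier L \<Longrightarrow> B z (x - y) = B z x - B z y"
  using B_add_left[of "x - y" y z] B_add_right[of "x - y" y z] by auto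

lemma B_sum_left:
  "(\<And>i. i \<in> A \<Longrightarrow> f i \<in> carrier L) \<Longrightarrow> z \<in> carrier L \<Longrightarrow> B (sum f A) z = (\<Sum>i\<in>A. B (f i) z)"
  by (induction A rule: infinite_finite_induct) (auto simp: B_add_left)

lemma B_sum_right:
  "(\<And>i. i \<in> A \<Longrightarrow> f i \<in> carrier L) \<Longrightarrow> z \<in> carrier L \<Longrightarrow> B z (sum f A) = (\<Sum>i\<in>A. B z (f i))"
  by (induction A rule: infinite_finite_induct) (auto simp: B_add_right)

lemma B_consistent: "x \<in> part L d \<Longrightarrow> y \<in> part L e \<Longrightarrow> d \<noteq> e \<Longrightarrow> B x y = 0"
  using metric by (auto simp: is_metric_def consistent_def)

lemma B_invariant:
  "homogeneous (part L) ds xs \<Longrightarrow> length xs = n - 1 \<Longrightarrow> y \<in> part L d \<Longrightarrow> z \<in> part L e \<Longrightarrow>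
     B (brk L (xs @ [y])) z = - sg (sum_list ds * d) * B y (brk L (xs @ [z]))"
  using metric unfolding is_metric_def invariant_def by blast

lemma B_supersymmetric: "x \<in> part L d \<Longrightarrow> y \<in> part L e \<Longrightarrow> B x y = sg (d * e) * B y x"
  using metric unfolding is_metric_def supersymmetric_def by blast

lemma B_nondegenerate: "x \<in> carrier L \<Longrightarrow> (\<And>y. y \<in> carrier L \<Longrightarrow> B x y = 0) \<Longrightarrow> x = 0"
  using metric by (auto simp: is_metric_def nondegenerate_def)

lemma B_eqI:
  "x \<in> carrier L \<Longrightarrow> y \<in> carrier L \<Longrightarrow> (\<And>z. z \<in> carrier L \<Longrightarrow> B x z = B y z) \<Longrightarrow> x = y"
  using B_nondegenerate[of "x - y"] by (simp add: B_diff_left)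

lemma B_component_left: "x \<in> carrier L \<Longrightarrow> y \<in> part L d \<Longrightarrow> B (comp d x) y = B x y"
  using B_consistent[OF minus_component_part, of x y d d] B_diff_left[of x "comp d x" y]
  by (simp add: part_carrier)

lemma B_component_right: "x \<in> carrier L \<Longrightarrow> y \<in> part L d \<Longrightarrow> B y (comp d x) = B y x"
  using B_consistent[OF _ minus_component_part, of y d x d] B_diff_right[of x "comp d x" y]
  by (simp add: part_carrier)

lemma B_components:
  assumes "x \<in> carrier L" "y \<in> carrier L"
  shows "B x y = (\<Sum>d\<in>UNIV. B (comp d x) (comp d y))"
proof -
  have "B x y = (\<Sum>d\<in>UNIV. B x (comp d y))"
    using assms by (simp add: component_sum flip: B_sum_right)
  then show ?thesis
    using assms by (simp add: B_component_left component_part)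
qed

lemma B_right_nondegenerate:
  assumes x: "x \<in> carrier L" and zero: "\<And>y. y \<in> carrier L \<Longrightarrow> B y x = 0"
  shows "x = 0"
proof -
  have "comp d x = 0" for d
  proof (rule B_nondegenerate)
    fix y assume y: "y \<in> carrier L"
    have "B (comp d x) y = B (comp d x) (comp d y)"
      using x y by (simp add: B_component_right component_part)
    also have "\<dots> = sg (d * d) * B (comp d y) (comp d x)"
      using x y by (intro B_supersymmetric component_part)
    also have "B (comp d y) (comp d x) = 0"
      using x y zero[of "comp d y"] by (simp add: B_component_right component_part)
    finally show "B (comp d x) y = 0" by simp
  qed (use x in auto)
  then show ?thesis using component_split[OF x] by simp
qed

text \<open>
  The signs in the invariance of \<open>B\<close> depend on degrees, but they do not matter for orthogonality;
  for graded sets one may therefore forget about degrees.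
\<close>

lemma brk_orthogonal:
  assumes X: "graded_subset X" and Y: "graded_subset Y"
    and orth: "\<And>x xs y. x \<in> X \<Longrightarrow> set xs \<subseteq> carrier L \<Longrightarrow> length xs = n - 1 \<Longrightarrow> y \<in> Y \<Longrightarrow>
      B x (brk L (xs @ [y])) = 0"
    and mem: "x \<in> X" "set xs \<subseteq> carrier L" "length xs = n - 1" "y \<in> Y"
  shows "B (brk L (xs @ [x])) y = 0"
proof -
  have xy: "x \<in> carrier L" "y \<in> carrier L" using X Y mem by (auto simp: graded_subset_def)
  have "brk L (xs @ [x]) \<in> {z \<in> carrier L. B z y = 0}"
  proof (rule brk_induct_homogeneous)
    show "set (xs @ [x]) \<subseteq> carrier L" "length (xs @ [x]) = n" using xy mem n_pos by auto
    show "subspace {z \<in> carrier L. B z y = 0}"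
      by (rule subspaceI) (use xy in \<open>auto simp: B_add_left B_scale_left\<close>)
    fix ds :: "bit list" assume "length ds = n"
    then obtain es e where ds: "ds = es @ [e]" "length es = n - 1"
      using n_pos by (cases ds rule: rev_cases) auto
    let ?ps = "map2 comp es xs" and ?x = "comp e x"
    have hom: "homogeneous (part L) es ?ps" "length ?ps = n - 1"
      using mem ds by (auto intro: homogeneous_components)
    have brk: "brk L (?ps @ [?x]) \<in> part L (sum_list es + e)"
      using hom xy by (intro brk_part_last component_part)
    let ?y = "comp (sum_list es + e) y"
    have "B (brk L (?ps @ [?x])) y = B (brk L (?ps @ [?x])) ?y"
      using brk xy by (simp add: B_component_right)
    also have "\<dots> = - sg (sum_list es * e) * B ?x (brk L (?ps @ [?y]))"
      by (rule B_invariant[OF hom component_part component_part]) (use xy in auto)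
    also have "B ?x (brk L (?ps @ [?y])) = 0"
      by (rule orth[OF _ homogeneous_carrier[OF hom(1)] hom(2)]) (use X Y mem in \<open>auto simp: graded_subsetD\<close>)
    finally show "brk L (map2 comp ds (xs @ [x])) \<in> {z \<in> carrier L. B z y = 0}"
      using part_carrier[OF brk] ds mem by simp
  qed
  then show ?thesis by simp
qed

text \<open>
  Invariance trades a bracket on the left for one on the right, so depth in the lower central
  series can be shifted from one argument to the other until the second one lies in \<open>lc k\<close>.
\<close>

lemma lc_orthogonal:
  assumes "lc k = {0}" "k \<le> i + j" "x \<in> lc i" "y \<in> lc j"
  shows "B x y = 0"
  using assms(2-4)
proof (induction i arbitrary: j x y)
  case 0
  then have "y = 0" using lc_antimono[of k j] assms(1) by auto
  then show ?case using 0 by simp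
next
  case (Suc i)
  have y: "y \<in> carrier L" using Suc.prems lc_carrier by auto
  let ?Z = "{z \<in> carrier L. B z y = 0}"
  have Z: "subspace ?Z"
    by (rule subspaceI) (use y in \<open>auto simp: B_add_left B_scale_left\<close>)
  have last: "brk L (xs @ [z]) \<in> ?Z" if "set xs \<subseteq> carrier L" "length xs = n - 1" "z \<in> lc i" for xs z
  proof -
    have "B (brk L (xs @ [z])) y = 0"
    proof (rule brk_orthogonal[OF lc_graded lc_graded _ that(3,1,2) Suc.prems(3)])
      fix x' xs' y' assume *: "x' \<in> lc i" "set xs' \<subseteq> carrier L" "length xs' = n - 1" "y' \<in> lc j"
      show "B x' (brk L (xs' @ [y'])) = 0"
        by (rule Suc.IH[of "Suc j"]) (use Suc.prems * brk_lc in \<open>auto simp del: lower_central.simps\<close>)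
    qed
    then show ?thesis using that lc_in_carrier by auto
  qed
  have "{brk L (z # xs) | z xs. z \<in> lc i \<and> set xs \<subseteq> carrier L \<and> length xs = n - 1} \<subseteq> ?Z"
  proof safe
    fix z xs assume *: "z \<in> lc i" "set xs \<subseteq> carrier L" "length xs = n - 1"
    have "brk L (z # xs) \<in> ?Z"
      by (rule brk_mem_any_position[OF lc_graded Z last, where i = 0])
        (use * lc_in_carrier n_pos in auto)
    then show "brk L (z # xs) \<in> carrier L" "B (brk L (z # xs)) y = 0" by auto
  qed
  from span_minimal[OF this Z] show ?case using Suc.prems by auto
qed

text \<open>
  By induction over \<open>U\<close>: either \<open>B g\<close> vanishes on the common kernel of the other functionals and
  can be dropped, or there is \<open>y0\<close> in this kernel with \<open>B g y0 \<noteq> 0\<close>, and subtracting the multiple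
  of \<open>B g\<close> that makes \<open>f\<close> vanish at \<open>y0\<close> leaves a functional to which the induction hypothesis
  applies. If \<open>U\<close> spans the whole space, the common kernel is zero by nondegeneracy; this is how
  every functional gets represented by a vector without a count of dimensions.
\<close>

lemma functional_in_span:
  assumes "finite U" "U \<subseteq> carrier L" "subspace D" "D \<subseteq> carrier L"
    "linear_map_on D (scal L) (*) f" "\<And>y. y \<in> D \<Longrightarrow> (\<And>u. u \<in> U \<Longrightarrow> B u y = 0) \<Longrightarrow> f y = 0"
  shows "\<exists>u\<in>span U. \<forall>y\<in>D. f y = B u y"
  using assms
proof (induction U arbitrary: f rule: finite_induct)
  case empty
  then show ?case by (auto intro!: bexI[of _ 0])
next
  case (insert g U)
  note D = \<open>subspace D\<close> \<open>D \<subseteq> carrier L\<close>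
  have g: "g \<in> carrier L" and U: "U \<subseteq> carrier L" using insert by auto
  have f: "f (x + y) = f x + f y" "f (scal L c x) = c * f x" if "x \<in> D" "y \<in> D" for x y c
    using insert.prems(4) that by (auto simp: linear_map_on_def)
  show ?case
  proof (cases "\<forall>y\<in>D. (\<forall>u\<in>U. B u y = 0) \<longrightarrow> B g y = 0")
    case True
    have "\<exists>u\<in>span U. \<forall>y\<in>D. f y = B u y"
      by (rule insert.IH[OF U D insert.prems(4)]) (use True insert.prems(5) in auto)
    then show ?thesis using span_mono[of U "insert g U"] by blast
  next
    case False
    then obtain y0 where y0: "y0 \<in> D" "\<forall>u\<in>U. B u y0 = 0" "B g y0 \<noteq> 0" by auto
    define a where "a = f y0 / B g y0"
    have "\<exists>u\<in>span U. \<forall>y\<in>D. f y - a * B g y = B u y"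
    proof (rule insert.IH[OF U D])
      show "linear_map_on D (scal L) (*) (\<lambda>y. f y - a * B g y)"
        using D g by (auto simp: linear_map_on_def f B_add_right B_scale_right subset_iff algebra_simps)
      fix y assume y: "y \<in> D" "\<And>u. u \<in> U \<Longrightarrow> B u y = 0"
      define b where "b = - (B g y / B g y0)"
      have by0: "scal L b y0 \<in> D" using y0 subspace_scale[OF D(1)] by auto
      have "f (y + scal L b y0) = 0"
      proof (rule insert.prems(5))
        show "y + scal L b y0 \<in> D" using y by0 subspace_add[OF D(1)] by auto
        fix u assume "u \<in> insert g U"
        then show "B u (y + scal L b y0) = 0"
          using y y0 g U D by (auto simp: B_add_right B_scale_right B_diff_right subset_iff b_def)
      qed
      then have "f y + b * f y0 = 0" using f y y0 by0 by simp
      then show "f y - a * B g y = 0" by (simp add: a_def b_def)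
    qed
    then obtain u where u: "u \<in> span U" "\<forall>y\<in>D. f y - a * B g y = B u y" by auto
    have uC: "u \<in> carrier L" using u U span_minimal[OF U subspace_carrier] by auto
    show ?thesis
    proof (intro bexI ballI)
      show "u + scal L a g \<in> span (insert g U)"
        by (rule span_add) (use u span_mono[of U "insert g U"] in \<open>auto intro: span_scale span_base\<close>)
      fix y assume "y \<in> D"
      with u D uC g have "B (u + scal L a g) y = B u y + a * B g y" "f y - a * B g y = B u y"
        by (auto simp: B_add_left B_scale_left subset_iff)
      then show "f y = B (u + scal L a g) y" by (simp add: algebra_simps)
    qed
  qed
qed

end

locale finite_metric_n_lie_space = metric_n_lie_space +
  assumes finite_dim: "finite_dimensional L"
begin

lemma functional_represented:
  assumes "subspace D" "D \<subseteq> carrier L" "linear_map_on D (scal L) (*) f"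
  shows "\<exists>u\<in>carrier L. \<forall>y\<in>D. f y = B u y"
proof -
  obtain U where U: "finite U" "span U = carrier L"
    using finite_dim by (auto simp: finite_dimensional_def)
  have UC: "U \<subseteq> carrier L" using U span_superset by auto
  have "\<exists>u\<in>span U. \<forall>y\<in>D. f y = B u y"
  proof (rule functional_in_span[OF U(1) UC assms])
    fix y assume y: "y \<in> D" "\<And>u. u \<in> U \<Longrightarrow> B u y = 0"
    have "subspace {u \<in> carrier L. B u y = 0}"
      by (rule subspaceI) (use y assms in \<open>auto simp: B_add_left B_scale_left subset_iff\<close>)
    then have "span U \<subseteq> {u \<in> carrier L. B u y = 0}"
      using y UC by (intro span_minimal) auto
    then have "y = 0" using U y assms by (intro B_right_nondegenerate) auto
    then show "f y = 0"
      using assms(3) y scale_zero_left[of 0] unfolding linear_map_on_def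
      by (metis mult_zero_left)
  qed
  then show ?thesis using U by simp
qed

end

section \<open>Graded duals and the ambient space of an extension\<close>

context graded_vector_space
begin

lemma dual_part_subspace: "module.subspace fscale (dual_part L d)"
proof -
  interpret F: vector_space "fscale :: 'k \<Rightarrow> ('a \<Rightarrow> 'k) \<Rightarrow> 'a \<Rightarrow> 'k"
    by unfold_locales (auto simp: fscale_def algebra_simps)
  show ?thesis
    by (rule F.subspaceI) (auto simp: dual_part_def linear_map_on_def fscale_def algebra_simps)
qed

lemma dual_part_disjoint:
  assumes "f \<in> dual_part L 0" "f \<in> dual_part L 1" shows "f = 0"
proof
  fix z show "f z = 0 z"
  proof (cases "z \<in> carrier L")
    case True
    then have "f z = f (comp 0 z) + f (comp 1 z)"
      using assms component_split[OF True]
      by (auto simp: dual_part_def linear_map_on_def) (metis component_carrier)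
    also have "\<dots> = 0"
      using assms True component_part[OF True] by (auto simp: dual_part_def)
    finally show ?thesis by simp
  qed (use assms in \<open>auto simp: dual_part_def\<close>)
qed

lemma Tstar_graded: "graded_space (Tstar n L \<theta>)"
proof -
  interpret T: vector_space "Tstar_scal L"
    by unfold_locales
      (auto simp: Tstar_scal_def fscale_def algebra_simps plus_fun_def scale_right_distrib scale_left_distrib)
  interpret F: vector_space "fscale :: 'k \<Rightarrow> ('a \<Rightarrow> 'k) \<Rightarrow> 'a \<Rightarrow> 'k"
    by unfold_locales (auto simp: fscale_def algebra_simps)
  have "T.subspace (Tstar_part L d)" for d
    using subspace_part[of d] dual_part_subspace[of d]
    by (auto simp: T.subspace_def subspace_def F.subspace_def Tstar_part_def Tstar_scal_def zero_prod_def)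
  moreover have "Tstar_part L 0 \<inter> Tstar_part L 1 = {0}"
    using part_disjoint[of _ 0] F.subspace_0[OF dual_part_subspace] dual_part_disjoint
    by (auto simp: Tstar_part_def zero_prod_def)
  ultimately show ?thesis
    using T.vector_space_axioms by (simp add: graded_space_def Tstar_def)
qed

end

section \<open>Halves of the identity\<close>

text \<open>
  The second assumption says that \<open>1 - \<sigma>\<close> is the adjoint of \<open>\<sigma>\<close>; the projection along a Lagrangian
  subspace onto an isotropic complement is the model case. The last one says that modulo the
  kernel of \<open>\<sigma>\<close> a bracket only depends on the images of its entries under \<open>\<sigma>\<close>, in other words that
  \<open>\<sigma>\<close> is a homomorphism onto its image with the bracket \<open>\<sigma> \<circ> brk L\<close>.
\<close>

locale half_splitting = finite_metric_n_lie_space n L B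
  for n and L :: "('k::field, 'a::ab_group_add) super_alg" and B +
  fixes \<sigma> :: "'a \<Rightarrow> 'a"
  assumes \<sigma>_even: "even_map \<sigma>"
    and \<sigma>_half: "x \<in> carrier L \<Longrightarrow> y \<in> carrier L \<Longrightarrow> B (\<sigma> x) y + B x (\<sigma> y) = B x y"
    and \<sigma>_brk_rest: "set xs \<subseteq> carrier L \<Longrightarrow> length xs = n \<Longrightarrow> y \<in> carrier L \<Longrightarrow> y - \<sigma> y \<in> set xs \<Longrightarrow>
      \<sigma> (brk L xs) = 0"
begin

definition \<tau> :: "'a \<Rightarrow> 'a" where "\<tau> x = x - \<sigma> x"

lemma \<sigma>_linear: "linear_map_on (carrier L) (scal L) (scal L) \<sigma>"
  using \<sigma>_even by (simp add: even_map_def)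

lemmas \<sigma>_add = even_mapD(1)[OF \<sigma>_even]
lemmas \<sigma>_scale = even_mapD(2)[OF \<sigma>_even]
lemmas \<sigma>_part = even_mapD(3)[OF \<sigma>_even]
lemmas \<sigma>_carrier [simp, intro] = even_map_carrier[OF \<sigma>_even]
lemmas \<sigma>_component = even_map_component[OF \<sigma>_even]

lemma \<sigma>_zero [simp]: "\<sigma> 0 = 0"
  using \<sigma>_scale[of 0 0] by simp

lemma \<sigma>_diff: "x \<in> carrier L \<Longrightarrow> y \<in> carrier L \<Longrightarrow> \<sigma> (x - y) = \<sigma> x - \<sigma> y"
  using \<sigma>_add[of "x - y" y] by simp

lemma \<sigma>_sum: "(\<And>i. i \<in> A \<Longrightarrow> f i \<in> carrier L) \<Longrightarrow> \<sigma> (sum f A) = (\<Sum>i\<in>A. \<sigma> (f i))"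
  by (induction A rule: infinite_finite_induct) (auto simp: \<sigma>_add)

lemma \<tau>_carrier [simp, intro]: "x \<in> carrier L \<Longrightarrow> \<tau> x \<in> carrier L"
  by (auto simp: \<tau>_def)

lemma \<tau>_part: "x \<in> part L d \<Longrightarrow> \<tau> x \<in> part L d"
  by (simp add: \<tau>_def \<sigma>_part subspace_diff[OF subspace_part])

lemma \<tau>_diff: "x \<in> carrier L \<Longrightarrow> y \<in> carrier L \<Longrightarrow> \<tau> (x - y) = \<tau> x - \<tau> y"
  by (simp add: \<tau>_def \<sigma>_diff)

lemma \<tau>_component: "x \<in> carrier L \<Longrightarrow> comp d (\<tau> x) = \<tau> (comp d x)"
  by (rule component_unique)
    (auto intro!: \<tau>_part component_part minus_component_part simp flip: \<tau>_diff)

lemma \<sigma>_plus_\<tau>: "\<sigma> x + \<tau> x = x"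
  by (simp add: \<tau>_def)

lemma B_\<tau>_left: "x \<in> carrier L \<Longrightarrow> y \<in> carrier L \<Longrightarrow> B (\<tau> x) y = B x (\<sigma> y)"
  using \<sigma>_half[of x y] by (simp add: \<tau>_def B_diff_left algebra_simps)

lemma \<sigma>_brk_\<tau>:
  "set xs \<subseteq> carrier L \<Longrightarrow> length xs = n \<Longrightarrow> y \<in> \<tau> ` carrier L \<Longrightarrow> y \<in> set xs \<Longrightarrow> \<sigma> (brk L xs) = 0"
  using \<sigma>_brk_rest by (auto simp: \<tau>_def)

text \<open>
  The sign in the invariance of \<open>B\<close> does not involve the degree of \<open>z\<close>, so \<open>z\<close> may be arbitrary.
\<close>

lemma B_invariant_right:
  assumes "homogeneous (part L) ds xs" "length xs = n - 1" "y \<in> part L d" "z \<in> carrier L"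
  shows "B (brk L (xs @ [y])) z = - sg (sum_list ds * d) * B y (brk L (xs @ [z]))"
proof -
  note C = homogeneous_carrier[OF assms(1)] part_carrier[OF assms(3)] assms(2,4)
  have b: "brk L (xs @ [y]) \<in> carrier L" "\<And>e. brk L (xs @ [comp e z]) \<in> carrier L"
    using C by auto
  have "B (brk L (xs @ [y])) z = (\<Sum>e\<in>UNIV. B (brk L (xs @ [y])) (comp e z))"
    using b C by (simp add: component_sum flip: B_sum_right)
  also have "\<dots> = (\<Sum>e\<in>UNIV. - sg (sum_list ds * d) * B y (brk L (xs @ [comp e z])))"
    using C by (intro sum.cong refl B_invariant[OF assms(1-3) component_part])
  also have "\<dots> = - sg (sum_list ds * d) * B y (\<Sum>e\<in>UNIV. brk L (xs @ [comp e z]))"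
    using b C by (simp add: sum_distrib_left B_sum_right)
  also have "(\<Sum>e\<in>UNIV. brk L (xs @ [comp e z])) = brk L (xs @ [z])"
    using multilinear_onD(1)[OF brk_multilinear, of xs "[]" "comp 0 z" "comp 1 z"]
      C n_pos component_split[of z] by (simp add: UNIV_bit)
  finally show ?thesis .
qed

lemma brk_split_update:
  assumes "set xs \<subseteq> carrier L" "length xs = n" "i < n" "u \<in> carrier L"
  shows "brk L (xs[i := u]) = brk L (xs[i := \<sigma> u]) + brk L (xs[i := \<tau> u])"
proof -
  have "linear_map_on (carrier L) (scal L) (scal L) (\<lambda>x. brk L (xs[i := x]))"
    using brk_multilinear assms unfolding multilinear_on_def by blast
  then have "brk L (xs[i := \<sigma> u + \<tau> u]) = brk L (xs[i := \<sigma> u]) + brk L (xs[i := \<tau> u])"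
    using assms by (auto simp: linear_map_on_def)
  then show ?thesis by (simp add: \<sigma>_plus_\<tau>)
qed

lemma brk_split:
  assumes "set pre \<subseteq> carrier L" "set post \<subseteq> carrier L" "x \<in> carrier L" "length pre + Suc (length post) = n"
  shows "brk L (pre @ x # post) = brk L (pre @ \<sigma> x # post) + brk L (pre @ \<tau> x # post)"
  using brk_split_update[of "pre @ x # post" "length pre" x] assms by simp

lemma \<sigma>_brk_\<sigma>:
  assumes "set pre \<subseteq> carrier L" "set post \<subseteq> carrier L" "x \<in> carrier L" "length pre + Suc (length post) = n"
  shows "\<sigma> (brk L (pre @ \<sigma> x # post)) = \<sigma> (brk L (pre @ x # post))"
proof -
  have "\<sigma> (brk L (pre @ \<tau> x # post)) = 0"
    by (rule \<sigma>_brk_\<tau>[of _ "\<tau> x"]) (use assms in auto)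
  moreover have "brk L (pre @ \<sigma> x # post) \<in> carrier L" "brk L (pre @ \<tau> x # post) \<in> carrier L"
    using assms by auto
  ultimately show ?thesis by (simp add: brk_split[OF assms] \<sigma>_add)
qed

text \<open>
  Invariance and the adjointness of \<open>\<sigma>\<close> and \<open>\<tau>\<close> give \<open>\<langle>[\<dots>, \<tau> u], w\<rangle> = \<plusminus> \<langle>u, \<sigma>[\<dots>, w]\<rangle>\<close>, which is
  zero because the remaining entries still contain a value of \<open>\<tau>\<close>.
\<close>

lemma brk_two_\<tau>:
  assumes C: "set pre \<subseteq> carrier L" "set post \<subseteq> carrier L" and len: "length pre + Suc (length post) = n"
    and y: "y \<in> \<tau> ` carrier L" and z: "z \<in> \<tau> ` carrier L" "z \<in> set (pre @ post)"
  shows "brk L (pre @ y # post) = 0"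
proof (rule B_nondegenerate)
  let ?xs = "pre @ y # post" and ?i = "length pre"
  have xs: "set ?xs \<subseteq> carrier L" "length ?xs = n" "?i < n" using C y len by auto
  then show "brk L ?xs \<in> carrier L" by (intro brk_carrier)
  fix w assume w: "w \<in> carrier L"
  have "brk L ?xs \<in> {v \<in> carrier L. B v w = 0}"
  proof (rule brk_induct_homogeneous[OF xs(1,2)])
    show "subspace {v \<in> carrier L. B v w = 0}"
      by (rule subspaceI) (use w in \<open>auto simp: B_add_left B_scale_left\<close>)
    fix ds :: "bit list" assume ds: "length ds = n"
    let ?ps = "map2 comp ds ?xs"
    define es where "es = take ?i ds @ drop (Suc ?i) ds"
    define d where "d = ds ! ?i"
    define qs where "qs = map2 comp es (pre @ post)"
    have hom: "homogeneous (part L) ds ?ps" "length ?ps = n"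
      using homogeneous_components[OF xs(1), of ds] xs(2) ds by simp_all
    have ds_split: "ds = take ?i ds @ d # drop (Suc ?i) ds"
      unfolding d_def using ds xs(3) by (simp add: id_take_nth_drop)
    have lens: "length (take ?i ds) = length pre" "length (drop (Suc ?i) ds) = length post"
      using ds len by auto
    have les: "length es = length (pre @ post)" using lens by (simp add: es_def)
    have "?ps = map2 comp (take ?i ds) pre @ comp d y # map2 comp (drop (Suc ?i) ds) post"
      using lens by (subst ds_split) simp
    then have ps: "omit ?i ?ps = qs" "?ps ! ?i = comp d y"
      using lens by (simp_all add: qs_def es_def nth_append)
    have homq: "homogeneous (part L) es qs" and lenq: "length qs = n - 1"
      unfolding qs_def using homogeneous_components[of "pre @ post" es] C les len by simp_all
    note Cq = homogeneous_carrier[OF homq]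
    obtain u where u: "u \<in> carrier L" "y = \<tau> u" using y by auto
    obtain v where v: "v \<in> carrier L" "z = \<tau> v" using z by auto
    obtain e where e: "comp e z \<in> set qs"
      using map2_member[OF z(2) les, of comp] unfolding qs_def by blast
    have compy: "comp d y = \<tau> (comp d u)" and compz: "comp e z = \<tau> (comp e v)"
      using u v by (auto simp: \<tau>_component)
    have "B (brk L (qs @ [\<tau> (comp d u)])) w
        = - sg (sum_list es * d) * B (\<tau> (comp d u)) (brk L (qs @ [w]))"
      by (rule B_invariant_right[OF homq lenq \<tau>_part[OF component_part[OF u(1)]] w])
    also have "B (\<tau> (comp d u)) (brk L (qs @ [w])) = B (comp d u) (\<sigma> (brk L (qs @ [w])))"
      by (rule B_\<tau>_left) (use u(1) w Cq lenq in auto)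
    also have "\<sigma> (brk L (qs @ [w])) = 0"
      by (rule \<sigma>_brk_\<tau>[of _ "comp e z"]) (use e compz v(1) w Cq lenq n_pos in auto)
    finally have "B (brk L (qs @ [comp d y])) w = 0" using u(1) compy by simp
    moreover have "brk L (qs @ [comp d y]) \<in> carrier L"
      using u(1) compy by (intro brk_carrier_last[OF Cq lenq]) simp
    ultimately have "B (brk L ?ps) w = 0"
      unfolding brk_move_last[OF hom xs(3)] ps using w by (simp add: B_scale_left)
    moreover have "brk L ?ps \<in> carrier L"
      by (intro brk_carrier homogeneous_carrier[OF hom(1)] hom(2))
    ultimately show "brk L ?ps \<in> {v \<in> carrier L. B v w = 0}" by simp
  qed
  then show "B (brk L ?xs) w = 0" by simp
qed

lemma brk_map_\<sigma>_one_\<tau>: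
  assumes "set pre \<subseteq> carrier L" "set xs \<subseteq> carrier L" "length pre + length xs = n"
    "z \<in> \<tau> ` carrier L" "z \<in> set pre"
  shows "brk L (pre @ xs) = brk L (pre @ map \<sigma> xs)"
  using assms
proof (induction xs arbitrary: pre)
  case Nil
  then show ?case by simp
next
  case (Cons x xs)
  have "brk L (pre @ x # xs) = brk L (pre @ \<sigma> x # xs) + brk L (pre @ \<tau> x # xs)"
    using Cons.prems by (intro brk_split) auto
  also have "brk L (pre @ \<tau> x # xs) = 0"
    using Cons.prems by (intro brk_two_\<tau>[of _ _ _ z]) auto
  finally show ?case
    using Cons.IH[of "pre @ [\<sigma> x]"] Cons.prems by simp
qed

text \<open>
  Expand every entry as \<open>\<sigma> x + \<tau> x\<close> and discard the terms with two values of \<open>\<tau>\<close>. What is left has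
  the shape of the bracket of a \<open>T\<^sup>*\<close>-extension: one term without and \<open>n\<close> terms with a functional.
\<close>

lemma brk_expand_\<sigma>\<tau>:
  assumes "set xs \<subseteq> carrier L" "length xs = n"
  shows "brk L xs = brk L (map \<sigma> xs) + (\<Sum>i<n. brk L ((map \<sigma> xs)[i := \<tau> (xs ! i)]))"
proof -
  have "brk L (pre @ xs) =
      brk L (pre @ map \<sigma> xs) + (\<Sum>i<length xs. brk L (pre @ (map \<sigma> xs)[i := \<tau> (xs ! i)]))"
    if "set pre \<subseteq> carrier L" "set xs \<subseteq> carrier L" "length pre + length xs = n" for pre xs
    using that
  proof (induction xs arbitrary: pre)
    case Nil
    then show ?case by simp
  next
    case (Cons x xs)
    have "brk L (pre @ x # xs) = brk L (pre @ \<sigma> x # xs) + brk L (pre @ \<tau> x # xs)"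
      using Cons.prems by (intro brk_split) auto
    also have "brk L (pre @ \<tau> x # xs) = brk L (pre @ \<tau> x # map \<sigma> xs)"
      using brk_map_\<sigma>_one_\<tau>[of "pre @ [\<tau> x]" xs "\<tau> x"] Cons.prems by simp
    also have "brk L (pre @ \<sigma> x # xs) = brk L (pre @ \<sigma> x # map \<sigma> xs) +
        (\<Sum>i<length xs. brk L (pre @ \<sigma> x # (map \<sigma> xs)[i := \<tau> (xs ! i)]))"
      using Cons.IH[of "pre @ [\<sigma> x]"] Cons.prems by simp
    finally show ?case
      by (simp add: sum.lessThan_Suc_shift algebra_simps del: sum.lessThan_Suc)
  qed
  from this[of "[]" xs] assms show ?thesis by simp
qed

end

section \<open>The quotient algebra and its cocycle\<close>

context half_splitting
begin

text \<open>
  The quotient by the kernel of \<open>\<sigma>\<close>, realised on the image of \<open>\<sigma>\<close>.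
\<close>

definition half_alg :: "('k, 'a) super_alg" where
  "half_alg = L\<lparr>part := \<lambda>d. \<sigma> ` part L d, brk := \<lambda>xs. \<sigma> (brk L xs)\<rparr>"

lemma half_alg_simps [simp]:
  "scal half_alg = scal L" "part half_alg d = \<sigma> ` part L d" "brk half_alg xs = \<sigma> (brk L xs)"
  by (auto simp: half_alg_def)

lemma half_carrier: "carrier half_alg = \<sigma> ` carrier L"
proof (intro equalityI subsetI)
  fix z assume "z \<in> carrier half_alg"
  then obtain x y where "x \<in> part L 0" "y \<in> part L 1" "z = \<sigma> x + \<sigma> y"
    by (auto simp: whole_def)
  then have "z = \<sigma> (x + y)" "x + y \<in> carrier L" by (auto simp: \<sigma>_add part_carrier)
  then show "z \<in> \<sigma> ` carrier L" by blast
next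
  fix z assume "z \<in> \<sigma> ` carrier L"
  then obtain x where x: "x \<in> carrier L" "z = \<sigma> x" by auto
  then have "z = \<sigma> (comp 0 x) + \<sigma> (comp 1 x)"
    using component_split[of x] by (simp flip: \<sigma>_add)
  then show "z \<in> carrier half_alg"
    using component_part[OF x(1)] unfolding whole_def by auto
qed

lemma half_part_subset: "part half_alg d \<subseteq> part L d"
  by (auto simp: \<sigma>_part)

lemma half_carrier_subset: "carrier half_alg \<subseteq> carrier L"
  by (auto simp: half_carrier)

lemma half_carrierD [simp, intro]: "x \<in> carrier half_alg \<Longrightarrow> x \<in> carrier L"
  using half_carrier_subset by auto

lemma half_homogeneous: "homogeneous (part half_alg) ds xs \<Longrightarrow> homogeneous (part L) ds xs"
  by (rule homogeneous_mono[OF _ half_part_subset])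

lemma \<sigma>_image_subspace:
  assumes "subspace X" "X \<subseteq> carrier L" shows "subspace (\<sigma> ` X)"
proof (rule subspaceI)
  show "0 \<in> \<sigma> ` X" using subspace_0[OF assms(1)] by force
next
  fix x y assume "x \<in> \<sigma> ` X" "y \<in> \<sigma> ` X"
  then obtain u v where "u \<in> X" "v \<in> X" "x = \<sigma> u" "y = \<sigma> v" by blast
  then have "x + y = \<sigma> (u + v)" "u + v \<in> X"
    using assms by (auto simp: \<sigma>_add subset_iff intro: subspace_add)
  then show "x + y \<in> \<sigma> ` X" by blast
next
  fix c x assume "x \<in> \<sigma> ` X"
  then obtain u where "u \<in> X" "x = \<sigma> u" by blast
  then have "scal L c x = \<sigma> (scal L c u)" "scal L c u \<in> X"
    using assms by (auto simp: \<sigma>_scale subset_iff intro: subspace_scale)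
  then show "scal L c x \<in> \<sigma> ` X" by blast
qed

lemma half_graded: "graded_space half_alg"
  unfolding graded_space_def
proof (intro conjI allI)
  show "vector_space (scal half_alg)" using vector_space_axioms by simp
  show "module.subspace (scal half_alg) (part half_alg d)" for d
    using \<sigma>_image_subspace[OF subspace_part] part_carrier by auto
  have "x = 0" if "x \<in> part half_alg 0" "x \<in> part half_alg 1" for x
    using that half_part_subset part_disjoint[of x 0] by auto
  then show "part half_alg 0 \<inter> part half_alg 1 = {0}"
    using imageI[OF zero_part, of \<sigma>] by auto
qed

sublocale H: graded_vector_space half_alg
  by standard (rule half_graded)

lemma half_multilinear_on:
  assumes "multilinear_on n (carrier L) (scal L) t F"
  shows "multilinear_on n (carrier half_alg) (scal half_alg) t F"
  unfolding multilinear_on_def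
proof (intro allI impI)
  fix xs :: "'a list" and i
  assume "length xs = n \<and> set xs \<subseteq> carrier half_alg \<and> i < n"
  then have "linear_map_on (carrier L) (scal L) t (\<lambda>x. F (xs[i := x]))"
    using assms half_carrier_subset unfolding multilinear_on_def by blast
  then show "linear_map_on (carrier half_alg) (scal half_alg) t (\<lambda>x. F (xs[i := x]))"
    by (auto simp: linear_map_on_def)
qed

lemma super_skew_half: "super_skew n (part L) t F \<Longrightarrow> super_skew n (part half_alg) t F"
  unfolding super_skew_def using half_homogeneous by blast

lemma set_update_carrier: "set xs \<subseteq> carrier L \<Longrightarrow> x \<in> carrier L \<Longrightarrow> set (xs[i := x]) \<subseteq> carrier L"
  using set_update_subset_insert[of xs i x] by auto

lemma multilinear_on_compose:
  assumes "multilinear_on n (carrier L) (scal L) (scal L) F"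
    "\<And>xs. set xs \<subseteq> carrier L \<Longrightarrow> length xs = n \<Longrightarrow> F xs \<in> carrier L"
    "linear_map_on (carrier L) (scal L) t G"
  shows "multilinear_on n (carrier L) (scal L) t (\<lambda>xs. G (F xs))"
  unfolding multilinear_on_def
proof (intro allI impI)
  fix xs :: "'a list" and i
  assume xs: "length xs = n \<and> set xs \<subseteq> carrier L \<and> i < n"
  then have "linear_map_on (carrier L) (scal L) (scal L) (\<lambda>x. F (xs[i := x]))"
    using assms(1) unfolding multilinear_on_def by blast
  moreover have "F (xs[i := x]) \<in> carrier L" if "x \<in> carrier L" for x
    using assms(2) xs that set_update_carrier by auto
  ultimately show "linear_map_on (carrier L) (scal L) t (\<lambda>x. G (F (xs[i := x])))"
    using assms(3) by (auto simp: linear_map_on_def)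
qed

lemma \<sigma>_brk_update:
  assumes "set xs \<subseteq> carrier L" "length xs = n" "i < n" "u \<in> carrier L"
  shows "\<sigma> (brk L (xs[i := \<sigma> u])) = \<sigma> (brk L (xs[i := u]))"
  using \<sigma>_brk_\<sigma>[of "take i xs" "drop (Suc i) xs" u] assms
  by (auto simp: upd_conv_take_nth_drop dest: in_set_takeD in_set_dropD)

text \<open>
  Since \<open>\<sigma> (brk L xs)\<close> does not change when \<open>\<sigma>\<close> is applied to an entry, every axiom is the image
  under \<open>\<sigma>\<close> of the axiom for \<open>L\<close>.
\<close>

lemma half_n_lie: "n_lie_superalgebra n half_alg"
  unfolding n_lie_superalgebra_def
proof (intro conjI allI impI)
  show "graded_space half_alg" by (rule half_graded)
  have "multilinear_on n (carrier L) (scal L) (scal L) (brk half_alg)"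
    using multilinear_on_compose[OF brk_multilinear _ \<sigma>_linear] by (simp add: half_alg_def)
  then show "multilinear_on n (carrier half_alg) (scal half_alg) (scal half_alg) (brk half_alg)"
    using half_multilinear_on by simp
  show "brk half_alg xs \<in> part half_alg (sum_list ds)"
    if "homogeneous (part half_alg) ds xs \<and> length xs = n" for ds xs
    using that brk_part half_homogeneous by auto
  show "super_skew n (part half_alg) (scal half_alg) (brk half_alg)"
    unfolding super_skew_def
  proof (intro allI impI)
    fix ds and xs :: "'a list" and i
    assume A: "homogeneous (part half_alg) ds xs \<and> length xs = n \<and> Suc i < n"
    then have "set xs \<subseteq> carrier L" using half_homogeneous homogeneous_carrier by blast
    then have "set (xs[i := xs ! Suc i, Suc i := xs ! i]) \<subseteq> carrier L"
      using A by (intro set_update_carrier) auto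
    moreover have "brk L xs = scal L (- sg (ds ! i * ds ! Suc i)) (brk L (xs[i := xs ! Suc i, Suc i := xs ! i]))"
      using A brk_skew half_homogeneous unfolding super_skew_def by blast
    ultimately show "brk half_alg xs = scal half_alg (- sg (ds ! i * ds ! Suc i))
        (brk half_alg (xs[i := xs ! Suc i, Suc i := xs ! i]))"
      using A by (simp add: \<sigma>_scale del: scale_minus_left)
  qed
  fix ds xs es ys
  assume A: "homogeneous (part half_alg) ds xs \<and> length xs = n - 1 \<and>
    homogeneous (part half_alg) es ys \<and> length ys = n"
  have hom: "homogeneous (part L) ds xs" "homogeneous (part L) es ys"
    using A half_homogeneous by blast+
  note C = homogeneous_carrier[OF hom(1)] homogeneous_carrier[OF hom(2)]
  have bc: "brk L (xs @ [ys ! i]) \<in> carrier L" if "i < n" for i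
    using C A that by (intro brk_carrier_last) auto
  have uc: "brk L (ys[i := brk L (xs @ [ys ! i])]) \<in> carrier L" if "i < n" for i
    by (rule brk_carrier[OF set_update_carrier[OF C(2) bc[OF that]]]) (use A in simp)
  have "brk half_alg (xs @ [brk half_alg ys]) = \<sigma> (brk L (xs @ [brk L ys]))"
    using \<sigma>_brk_\<sigma>[of xs "[]" "brk L ys"] A C n_pos by simp
  also have "brk L (xs @ [brk L ys]) =
      (\<Sum>i<n. scal L (sg (sum_list ds * sum_list (take i es))) (brk L (ys[i := brk L (xs @ [ys ! i])])))"
    using A hom by (intro brk_leibniz) auto
  also have "\<sigma> \<dots> = (\<Sum>i<n. scal L (sg (sum_list ds * sum_list (take i es)))
      (\<sigma> (brk L (ys[i := brk L (xs @ [ys ! i])]))))"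
    using uc by (subst \<sigma>_sum) (auto simp: \<sigma>_scale)
  also have "\<dots> = (\<Sum>i<n. scal half_alg (sg (sum_list ds * sum_list (take i es)))
      (brk half_alg (ys[i := brk half_alg (xs @ [ys ! i])])))"
    using \<sigma>_brk_update C A bc by (intro sum.cong) auto
  finally show "brk half_alg (xs @ [brk half_alg ys]) = (\<Sum>i<n. scal half_alg (sg (sum_list ds * sum_list (take i es)))
      (brk half_alg (ys[i := brk half_alg (xs @ [ys ! i])])))" .
qed

lemma half_lower_central: "lower_central n half_alg m \<subseteq> \<sigma> ` lc m"
proof (induction m)
  case 0
  then show ?case by (simp add: half_carrier)
next
  case (Suc m)
  have "{brk half_alg (x # xs) | x xs. x \<in> lower_central n half_alg m \<and>
      set xs \<subseteq> carrier half_alg \<and> length xs = n - 1} \<subseteq> \<sigma> ` lc (Suc m)"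
  proof safe
    fix x xs
    assume A: "x \<in> lower_central n half_alg m" "set xs \<subseteq> carrier half_alg" "length xs = n - 1"
    then obtain y where y: "y \<in> lc m" "x = \<sigma> y" using Suc by auto
    have xs: "set xs \<subseteq> carrier L" using A half_carrier_subset by auto
    have "brk half_alg (x # xs) = \<sigma> (brk L (y # xs))"
      using \<sigma>_brk_\<sigma>[of "[]" xs y] A xs y n_pos lc_in_carrier by simp
    moreover have "brk L (y # xs) \<in> lc (Suc m)"
      using y A xs by (auto intro!: span_base exI)
    ultimately show "brk half_alg (x # xs) \<in> \<sigma> ` lc (Suc m)" by blast
  qed
  then have "span {brk half_alg (x # xs) | x xs. x \<in> lower_central n half_alg m \<and>
      set xs \<subseteq> carrier half_alg \<and> length xs = n - 1} \<subseteq> \<sigma> ` lc (Suc m)"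
    by (rule span_minimal) (intro \<sigma>_image_subspace lc_subspace lc_carrier)
  then show ?case by (simp only: lower_central.simps(2)[of n half_alg] half_alg_simps(1))
qed

text \<open>
  The value outside the carrier is the one that membership in \<open>dual_part\<close> requires.
\<close>

definition res :: "'a \<Rightarrow> 'a \<Rightarrow> 'k" where
  "res u = (\<lambda>z. if z \<in> carrier half_alg then B u z else 0)"

lemma res_add: "x \<in> carrier L \<Longrightarrow> y \<in> carrier L \<Longrightarrow> res (x + y) = res x + res y"
  and res_diff: "x \<in> carrier L \<Longrightarrow> y \<in> carrier L \<Longrightarrow> res (x - y) = res x - res y"
  and res_scale: "x \<in> carrier L \<Longrightarrow> res (scal L c x) = fscale c (res x)"
  by (auto simp: res_def fun_eq_iff B_add_left B_diff_left B_scale_left fscale_def)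

lemma res_zero [simp]: "res 0 = 0"
  by (auto simp: res_def fun_eq_iff)

lemma res_sum: "(\<And>i. i \<in> A \<Longrightarrow> f i \<in> carrier L) \<Longrightarrow> res (sum f A) = (\<Sum>i\<in>A. res (f i))"
  by (induction A rule: infinite_finite_induct) (auto simp: res_add)

lemma res_eqI: "(\<And>z. z \<in> carrier half_alg \<Longrightarrow> B x z = B y z) \<Longrightarrow> res x = res y"
  by (auto simp: res_def)

lemma res_linear: "linear_map_on (carrier L) (scal L) fscale res"
  by (simp add: linear_map_on_def res_add res_scale)

lemma res_dual: "u \<in> part L d \<Longrightarrow> res u \<in> dual_part half_alg d"
  using B_consistent[of u d _ "d + 1"] \<sigma>_part[of _ "d + 1"]
  by (auto simp: dual_part_def linear_map_on_def res_def B_add_right B_scale_right part_carrier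
      H.carrier_closed(2,3)[simplified])

text \<open>
  Some vector represents \<open>f\<close> by nondegeneracy. Since \<open>f\<close> vanishes in the other degree, the
  component of degree \<open>d\<close> of this vector represents \<open>f\<close> as well.
\<close>

lemma dual_represented:
  assumes f: "f \<in> dual_part half_alg d"
  shows "\<exists>u\<in>part L d. f = res u"
proof -
  have lin: "linear_map_on (carrier half_alg) (scal L) (*) f"
    using f by (simp add: dual_part_def)
  obtain u where u: "u \<in> carrier L" "\<forall>y\<in>carrier half_alg. f y = B u y"
    using functional_represented[OF _ half_carrier_subset lin] H.subspace_carrier by auto
  have "f = res (comp d u)"
  proof
    fix y show "f y = res (comp d u) y"
    proof (cases "y \<in> carrier half_alg")
      case True
      then obtain x where x: "x \<in> carrier L" "y = \<sigma> x" by (auto simp: half_carrier)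
      have comps: "comp e y \<in> \<sigma> ` part L e" for e
        using x by (auto simp: \<sigma>_component component_part)
      then have compc: "comp e y \<in> carrier half_alg" for e
        using H.part_carrier[of "comp e y" e] comps by simp
      have "f y = f (comp d y) + f (comp (d + 1) y)"
        using lin compc component_split[of y] True bit_cases[of d]
        by (auto simp: linear_map_on_def add.commute) (metis)+
      also have "f (comp (d + 1) y) = 0"
        using f comps[of "d + 1"] by (auto simp: dual_part_def)
      also have "f (comp d y) = B u (comp d y)" using u compc by auto
      also have "\<dots> = B (comp d u) y"
        using B_component_left[OF u(1) component_part[OF half_carrierD[OF True]], of d]
          B_component_right[OF half_carrierD[OF True] component_part[OF u(1)], of d] by simp
      finally show ?thesis using True by (simp add: res_def)
    qed (use f in \<open>auto simp: dual_part_def res_def\<close>)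
  qed
  then show ?thesis using u component_part by blast
qed

definition half_cocycle :: "'a list \<Rightarrow> 'a \<Rightarrow> 'k" where
  "half_cocycle xs = res (brk L xs)"

text \<open>
  The coadjoint action feeds \<open>\<sigma>[xs, z]\<close> into \<open>B u\<close>. Moving \<open>\<sigma>\<close> to the other side turns it into \<open>\<tau>\<close>,
  and invariance then moves the bracket over, with exactly the sign in the definition of \<open>coad\<close>.
\<close>

lemma coad_res:
  assumes "homogeneous (part L) ds xs" "length xs = n - 1" "u \<in> part L e"
  shows "coad half_alg (sum_list ds) xs e (res u) = res (brk L (xs @ [\<tau> u]))"
proof
  fix z show "coad half_alg (sum_list ds) xs e (res u) z = res (brk L (xs @ [\<tau> u])) z"
  proof (cases "z \<in> carrier half_alg")
    case True
    note C = homogeneous_carrier[OF assms(1)]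
    have b: "brk L (xs @ [z]) \<in> carrier L" using True C assms by auto
    have "B (brk L (xs @ [\<tau> u])) z = - sg (sum_list ds * e) * B (\<tau> u) (brk L (xs @ [z]))"
      using True by (intro B_invariant_right[OF assms(1,2)] \<tau>_part assms(3)) auto
    also have "B (\<tau> u) (brk L (xs @ [z])) = B u (\<sigma> (brk L (xs @ [z])))"
      using b assms by (simp add: B_\<tau>_left part_carrier)
    finally show ?thesis using b True by (simp add: coad_def res_def half_carrier)
  qed (simp add: coad_def res_def)
qed

lemma omit_update [simp]: "omit i (xs[i := y]) = omit i xs"
  by (simp add: omit_def)

lemma mixed_brk_res:
  assumes "homogeneous (part L) ds (xs[i := u])" "length xs = n" "i < n"
  shows "mixed_brk half_alg ds xs i (res u) = res (brk L (xs[i := \<tau> u]))"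
proof -
  have len: "length ds = n" using homogeneous_length[OF assms(1)] assms by simp
  have u: "u \<in> part L (ds ! i)" using homogeneous_nth[OF assms(1), of i] assms by simp
  have hom: "homogeneous (part L) ds (xs[i := \<tau> u])"
    using homogeneous_update[OF assms(1) \<tau>_part[OF u], of i] by simp
  have homo: "homogeneous (part L) (omit i ds) (omit i xs)" "length (omit i xs) = n - 1"
    using homogeneous_omit[OF assms(1), of i] assms by auto
  let ?c = "(- 1) ^ (n - Suc i) * sg (ds ! i * sum_list (drop (Suc i) ds))"
  have "brk L (xs[i := \<tau> u]) = scal L ?c (brk L (omit i xs @ [\<tau> u]))"
    using brk_move_last[OF hom] assms by simp
  moreover have "brk L (omit i xs @ [\<tau> u]) \<in> carrier L"
    using homo homogeneous_carrier[OF homo(1)] part_carrier[OF u] by (intro brk_carrier_last) auto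
  ultimately show ?thesis
    using coad_res[OF homo u] assms by (simp add: mixed_brk_def res_scale)
qed

text \<open>
  All terms are values of \<open>res\<close> at iterated brackets of \<open>L\<close> with \<open>\<sigma>\<close> or \<open>\<tau>\<close> applied to the inner
  bracket: \<open>\<sigma>\<close> where the inner bracket is the one of the quotient, \<open>\<tau>\<close> where a functional is acted
  upon. They occur in pairs \<open>\<sigma> v\<close>, \<open>\<tau> v\<close> with sum \<open>v\<close>, and the sums cancel by the fundamental
  identity of \<open>L\<close> for the entries \<open>ys @ [z]\<close>.
\<close>

lemma half_cocycle_delta:
  assumes xs: "homogeneous (part L) ds xs" "length xs = n - 1"
    and ys: "homogeneous (part L) es ys" "length ys = n - 1" and z: "z \<in> part L c"
  shows "delta half_alg half_cocycle ds xs es ys c z = 0"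
proof -
  define a b where "a = sum_list ds" and "b = sum_list es"
  (* D v is the sum in the fundamental identity with the inner brackets U i replaced by v i. *)
  define U where "U i = brk L (xs @ [ys ! i])" for i
  define s where "s i = (sg (a * sum_list (take i es)) :: 'k)" for i
  define D where "D v = (\<Sum>i<length ys. fscale (s i) (res (brk L (ys[i := v i] @ [z]))))" for v
  note C = homogeneous_carrier[OF xs(1)] homogeneous_carrier[OF ys(1)] part_carrier[OF z]
  have les: "length es = n - 1" using homogeneous_length[OF ys(1)] ys by simp
  have U_part: "U i \<in> part L (a + es ! i)" if "i < length ys" for i
    unfolding U_def a_def using homogeneous_nth[OF ys(1) that] by (rule brk_part_last[OF xs])
  have UC: "U i \<in> carrier L" if "i < length ys" for i using part_carrier[OF U_part[OF that]] .
  have brkC: "brk L (ys[i := v] @ [z]) \<in> carrier L" if "v \<in> carrier L" for i v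
    using C ys set_update_carrier[OF C(2) that] by (intro brk_carrier_last) auto
  have yz: "brk L (ys @ [z]) \<in> part L (b + c)" and xz: "brk L (xs @ [z]) \<in> part L (a + c)"
    unfolding a_def b_def using brk_part_last xs ys z by auto
  note yzC = part_carrier[OF yz] and xzC = part_carrier[OF xz]
  have last: "res (brk L (ws @ [\<sigma> v])) + res (brk L (ws @ [\<tau> v])) = res (brk L (ws @ [v]))"
    if "set ws \<subseteq> carrier L" "length ws = n - 1" "v \<in> carrier L" for ws v
    using brk_split[of ws "[]" v] that n_pos by (simp flip: res_add)
  have d1: "(\<Sum>i<length ys. fscale (sg (a * sum_list (take i es)))
      (half_cocycle (ys[i := brk half_alg (xs @ [ys ! i])] @ [z]))) = D (\<lambda>i. \<sigma> (U i))"
    by (simp add: D_def s_def U_def half_cocycle_def)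
  have d2: "half_cocycle (ys @ [brk half_alg (xs @ [z])]) = res (brk L (ys @ [\<sigma> (brk L (xs @ [z]))]))"
    "half_cocycle (xs @ [brk half_alg (ys @ [z])]) = res (brk L (xs @ [\<sigma> (brk L (ys @ [z]))]))"
    by (simp_all add: half_cocycle_def)
  have d3: "coad half_alg a xs (b + c) (half_cocycle (ys @ [z])) = res (brk L (xs @ [\<tau> (brk L (ys @ [z]))]))"
    "coad half_alg b ys (a + c) (half_cocycle (xs @ [z])) = res (brk L (ys @ [\<tau> (brk L (xs @ [z]))]))"
    unfolding half_cocycle_def a_def b_def
    using coad_res[OF xs, OF yz] coad_res[OF ys, OF xz] by (simp_all add: a_def b_def)
  have "mixed_brk half_alg (es[i := a + es ! i] @ [c]) (ys @ [z]) i (half_cocycle (xs @ [ys ! i]))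
      = res (brk L (ys[i := \<tau> (U i)] @ [z]))" if i: "i < length ys" for i
  proof -
    have "homogeneous (part L) (es[i := a + es ! i] @ [c]) (ys[i := U i] @ [z])"
      using z by (intro homogeneous_appendI homogeneous_update ys U_part i) auto
    then show ?thesis
      using mixed_brk_res[of "es[i := a + es ! i] @ [c]" "ys @ [z]" i "U i"] i ys n_pos
      by (simp add: half_cocycle_def U_def list_update_append)
  qed
  then have d4: "(\<Sum>i<length ys. fscale (sg (a * sum_list (take i es)))
      (mixed_brk half_alg (es[i := a + es ! i] @ [c]) (ys @ [z]) i (half_cocycle (xs @ [ys ! i]))))
      = D (\<lambda>i. \<tau> (U i))"
    by (simp add: D_def s_def)
  have D_add: "D (\<lambda>i. \<sigma> (U i)) + D (\<lambda>i. \<tau> (U i)) = D U"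
  proof -
    have "fscale (s i) (res (brk L (ys[i := \<sigma> (U i)] @ [z]))) + fscale (s i) (res (brk L (ys[i := \<tau> (U i)] @ [z])))
        = fscale (s i) (res (brk L (ys[i := U i] @ [z])))" if i: "i < length ys" for i
    proof -
      have "brk L ((ys @ [z])[i := U i]) = brk L ((ys @ [z])[i := \<sigma> (U i)]) + brk L ((ys @ [z])[i := \<tau> (U i)])"
        using C ys n_pos i UC[OF i] by (intro brk_split_update) auto
      then have "res (brk L (ys[i := U i] @ [z])) = res (brk L (ys[i := \<sigma> (U i)] @ [z])) + res (brk L (ys[i := \<tau> (U i)] @ [z]))"
        using i brkC UC[OF i] by (simp add: list_update_append flip: res_add)
      then show ?thesis by (simp add: fscale_def fun_eq_iff algebra_simps)
    qed
    then show ?thesis unfolding D_def by (simp flip: sum.distrib)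
  qed
  have leibniz: "res (brk L (xs @ [brk L (ys @ [z])])) = D U + fscale (sg (a * b)) (res (brk L (ys @ [brk L (xs @ [z])])))"
  proof -
    have n: "n = Suc (length ys)" using ys n_pos by simp
    have hom: "homogeneous (part L) (es @ [c]) (ys @ [z])" using ys z by (simp add: homogeneous_appendI)
    have "brk L (xs @ [brk L (ys @ [z])]) = (\<Sum>i<Suc (length ys). scal L (sg (a * sum_list (take i (es @ [c]))))
        (brk L ((ys @ [z])[i := brk L (xs @ [(ys @ [z]) ! i])])))"
      using brk_leibniz[OF xs hom] n unfolding a_def by simp
    also have "\<dots> = (\<Sum>i<length ys. scal L (s i) (brk L (ys[i := U i] @ [z])))
        + scal L (sg (a * b)) (brk L (ys @ [brk L (xs @ [z])]))"
      using les ys by (simp add: s_def U_def b_def list_update_append nth_append)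
    finally have "brk L (xs @ [brk L (ys @ [z])]) = \<dots>" .
    moreover have "brk L (ys @ [brk L (xs @ [z])]) \<in> carrier L"
      by (rule brk_carrier_last[OF C(2) ys(2) xzC])
    moreover have "brk L (ys[i := U i] @ [z]) \<in> carrier L" if "i < length ys" for i
      by (rule brkC[OF UC[OF that]])
    moreover have "(\<Sum>i<length ys. scal L (s i) (brk L (ys[i := U i] @ [z]))) \<in> carrier L"
      by (intro carrier_closed calculation) auto
    moreover have "res (\<Sum>i<length ys. scal L (s i) (brk L (ys[i := U i] @ [z]))) = D U"
      unfolding D_def
      by (subst res_sum) (use brkC UC in \<open>auto intro!: sum.cong res_scale carrier_closed(3)\<close>)
    ultimately show ?thesis
      by (simp add: res_add res_scale)
  qed
  have "delta half_alg half_cocycle ds xs es ys c z =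
      - D (\<lambda>i. \<sigma> (U i)) - fscale (sg (a * b)) (res (brk L (ys @ [\<sigma> (brk L (xs @ [z]))])))
      + res (brk L (xs @ [\<sigma> (brk L (ys @ [z]))])) + res (brk L (xs @ [\<tau> (brk L (ys @ [z]))]))
      - fscale (sg (a * b)) (res (brk L (ys @ [\<tau> (brk L (xs @ [z]))]))) - D (\<lambda>i. \<tau> (U i))"
    unfolding delta_def Let_def a_def[symmetric] b_def[symmetric] d1 d2 d3 d4 ..
  also have "\<dots> = (res (brk L (xs @ [\<sigma> (brk L (ys @ [z]))])) + res (brk L (xs @ [\<tau> (brk L (ys @ [z]))])))
      - (D (\<lambda>i. \<sigma> (U i)) + D (\<lambda>i. \<tau> (U i)))
      - fscale (sg (a * b)) (res (brk L (ys @ [\<sigma> (brk L (xs @ [z]))])) + res (brk L (ys @ [\<tau> (brk L (xs @ [z]))])))"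
    by (simp add: fun_eq_iff fscale_def algebra_simps)
  also have "\<dots> = 0"
    unfolding last[OF C(1) xs(2) yzC] last[OF C(2) ys(2) xzC] D_add leibniz by simp
  finally show ?thesis .
qed

lemma half_cocycle_mem: "half_cocycle \<in> even_cocycles n half_alg"
  unfolding even_cocycles_def mem_Collect_eq
proof (intro conjI allI impI)
  show "multilinear_on n (carrier half_alg) (scal half_alg) fscale half_cocycle"
    using half_multilinear_on[OF multilinear_on_compose[OF brk_multilinear brk_carrier res_linear]]
    by (simp add: half_cocycle_def[abs_def])
  show "half_cocycle xs \<in> dual_part half_alg (sum_list ds)"
    if "homogeneous (part half_alg) ds xs \<and> length xs = n" for ds xs
    unfolding half_cocycle_def using that by (intro res_dual brk_part half_homogeneous) auto
  have "super_skew n (part L) fscale half_cocycle"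
    unfolding super_skew_def
  proof (intro allI impI)
    fix ds and xs :: "'a list" and i
    assume A: "homogeneous (part L) ds xs \<and> length xs = n \<and> Suc i < n"
    then have "set xs \<subseteq> carrier L" using homogeneous_carrier by blast
    then have C: "set (xs[i := xs ! Suc i, Suc i := xs ! i]) \<subseteq> carrier L"
      using A by (intro set_update_carrier) auto
    have "brk L xs = scal L (- sg (ds ! i * ds ! Suc i)) (brk L (xs[i := xs ! Suc i, Suc i := xs ! i]))"
      using A brk_skew unfolding super_skew_def by blast
    then show "half_cocycle xs = fscale (- sg (ds ! i * ds ! Suc i))
        (half_cocycle (xs[i := xs ! Suc i, Suc i := xs ! i]))"
      using A C by (simp add: half_cocycle_def res_scale del: scale_minus_left)
  qed
  then show "super_skew n (part half_alg) fscale half_cocycle" by (rule super_skew_half)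
  show "delta half_alg half_cocycle ds xs es ys c z = 0"
    if "homogeneous (part half_alg) ds xs \<and> length xs = n - 1 \<and>
      homogeneous (part half_alg) es ys \<and> length ys = n - 1 \<and> z \<in> part half_alg c" for ds xs es ys c z
    using that half_part_subset by (intro half_cocycle_delta half_homogeneous) auto
qed

text \<open>
  Moving \<open>z\<close> through the bracket by invariance and to the front by supersymmetry produces the
  signs \<open>- sg (|xs||z|)\<close> and \<open>sg ((|xs| + |y|)|z|)\<close>, and the quotient of the two is \<open>- sg (|y||z|)\<close>.
\<close>

lemma half_cocycle_cyclic: "cyclic_condition n half_alg half_cocycle"
  unfolding cyclic_condition_def
proof (intro allI impI)
  fix ds xs d y e z
  assume A: "homogeneous (part half_alg) ds xs \<and> length xs = n - 1 \<and> y \<in> part half_alg d \<and> z \<in> part half_alg e"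
  have hom: "homogeneous (part L) ds xs" "length xs = n - 1" and y: "y \<in> part L d" and z: "z \<in> part L e"
    using A half_part_subset by (auto intro: half_homogeneous)
  have "B (brk L (xs @ [y])) z = sg ((sum_list ds + d) * e) * B z (brk L (xs @ [y]))"
    by (rule B_supersymmetric[OF brk_part_last[OF hom y] z])
  moreover have "B (brk L (xs @ [z])) y = - sg (sum_list ds * e) * B z (brk L (xs @ [y]))"
    by (rule B_invariant[OF hom z y])
  ultimately have "B (brk L (xs @ [y])) z + sg (d * e) * B (brk L (xs @ [z])) y = 0"
    by (simp add: distrib_right sg_add)
  then show "half_cocycle (xs @ [y]) z + sg (d * e) * half_cocycle (xs @ [z]) y = 0"
    using A H.part_carrier[of y d] H.part_carrier[of z e] by (simp add: half_cocycle_def res_def)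
qed

section \<open>The embedding into the extension\<close>

abbreviation T :: "('k, 'a \<times> ('a \<Rightarrow> 'k)) super_alg" where
  "T \<equiv> Tstar n half_alg half_cocycle"

sublocale T: graded_vector_space T
  by standard (rule H.Tstar_graded)

lemma T_simps: "scal T = Tstar_scal half_alg" "part T = Tstar_part half_alg"
  by (simp_all add: Tstar_def)

text \<open>
  The form of the extension gives \<open>\<langle>emb x, emb y\<rangle> = B x (\<sigma> y) + B (\<sigma> x) y\<close>, so that \<open>\<sigma>_half\<close> says
  precisely that \<open>emb\<close> is isometric.
\<close>

definition emb :: "'a \<Rightarrow> 'a \<times> ('a \<Rightarrow> 'k)" where
  "emb x = (\<sigma> x, res x)"

lemma emb_linear: "linear_map_on (carrier L) (scal L) (scal T) emb"
  by (auto simp: linear_map_on_def emb_def \<sigma>_add \<sigma>_scale res_add res_scale T_simps Tstar_scal_def)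

lemma emb_add: "x \<in> carrier L \<Longrightarrow> y \<in> carrier L \<Longrightarrow> emb (x + y) = emb x + emb y"
  and emb_scale: "x \<in> carrier L \<Longrightarrow> emb (scal L c x) = scal T c (emb x)"
  using emb_linear by (auto simp: linear_map_on_def)

lemma emb_zero [simp]: "emb 0 = 0"
  by (simp add: emb_def zero_prod_def)

lemma emb_sum: "(\<And>i. i \<in> A \<Longrightarrow> f i \<in> carrier L) \<Longrightarrow> emb (sum f A) = (\<Sum>i\<in>A. emb (f i))"
  by (induction A rule: infinite_finite_induct) (auto simp: emb_add)

lemma emb_part: "x \<in> part L d \<Longrightarrow> emb x \<in> part T d"
  using res_dual by (auto simp: emb_def T_simps Tstar_part_def)

lemma emb_diff: "x \<in> carrier L \<Longrightarrow> y \<in> carrier L \<Longrightarrow> emb (x - y) = emb x - emb y"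
  using emb_add[of "x - y" y] by simp

lemma emb_component: "x \<in> carrier L \<Longrightarrow> T.comp d (emb x) = emb (comp d x)"
  by (rule T.component_unique)
    (auto intro!: emb_part component_part minus_component_part simp flip: emb_diff)

lemma emb_carrier: "x \<in> carrier L \<Longrightarrow> emb x \<in> carrier T"
  using emb_add[of "comp 0 x" "comp 1 x"] component_split[of x]
    T.part_carrier[OF emb_part[OF component_part]]
  by (metis T.carrier_closed(2) component_carrier)

lemma res_eq_iff:
  assumes "x \<in> carrier L" "y \<in> carrier L"
  shows "res x = res y \<longleftrightarrow> \<tau> x = \<tau> y"
proof
  assume "res x = res y"
  then have "B x (\<sigma> z) = B y (\<sigma> z)" if "z \<in> carrier L" for z
    using that unfolding res_def half_carrier fun_eq_iff by (metis imageI)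
  then show "\<tau> x = \<tau> y"
    using assms by (intro B_eqI) (auto simp: B_\<tau>_left)
next
  assume "\<tau> x = \<tau> y"
  then have "B x (\<sigma> z) = B y (\<sigma> z)" if "z \<in> carrier L" for z
    using assms that B_\<tau>_left by metis
  then show "res x = res y" by (intro res_eqI) (auto simp: half_carrier)
qed

lemma emb_eq_iff:
  assumes "x \<in> carrier L" "y \<in> carrier L"
  shows "emb x = emb y \<longleftrightarrow> x = y"
  unfolding emb_def prod.inject res_eq_iff[OF assms] by (metis \<sigma>_plus_\<tau>)

lemma T_element:
  assumes "p \<in> part T d"
  obtains x u where "x \<in> part L d" "u \<in> part L d" "p = (\<sigma> x, res u)"
  using assms dual_represented[of "snd p" d]
  by (cases p) (auto simp: T_simps Tstar_part_def)

text \<open>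
  The coadjoint terms are brackets of \<open>L\<close> with an entry \<open>\<tau> u\<close>, and \<open>\<sigma>\<close> vanishes on these, so they
  can be added to the first component for free. Hence brackets of the extension lie in the image
  of \<open>emb\<close> even if their entries do not.
\<close>

lemma T_brk_homogeneous:
  assumes xs: "homogeneous (part L) ds xs" "length xs = n" and us: "homogeneous (part L) ds us"
    and ps: "length ps = n" "\<And>i. i < n \<Longrightarrow> ps ! i = (\<sigma> (xs ! i), res (us ! i))"
  shows "Tstar_brk_hom half_alg half_cocycle ds ps =
    emb (brk L (map \<sigma> xs) + (\<Sum>i<n. brk L ((map \<sigma> xs)[i := \<tau> (us ! i)])))"
proof -
  let ?xs = "map \<sigma> xs"
  have fst: "map fst ps = ?xs" by (rule nth_equalityI) (use xs ps in auto)
  have len: "length ds = n" "length us = n" using homogeneous_length[OF us] homogeneous_length[OF xs(1)] xs by auto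
  have hom: "homogeneous (part L) ds ?xs" by (rule homogeneous_map[OF xs(1) \<sigma>_part])
  note C = homogeneous_carrier[OF hom] homogeneous_carrier[OF us]
  have uc: "us ! i \<in> carrier L" if "i < n" for i using C(2) len that by auto
  have Z: "brk L (?xs[i := \<tau> (us ! i)]) \<in> carrier L" if "i < n" for i
    by (rule brk_carrier[OF set_update_carrier[OF C(1) \<tau>_carrier[OF uc[OF that]]]]) (use xs in simp)
  have b: "brk L ?xs \<in> carrier L" using C xs by (intro brk_carrier) auto
  have \<sigma>0: "\<sigma> (brk L (?xs[i := \<tau> (us ! i)])) = 0" if "i < n" for i
    by (rule \<sigma>_brk_\<tau>[OF set_update_carrier[OF C(1) \<tau>_carrier[OF uc[OF that]]], where y = "\<tau> (us ! i)"])
      (use xs that uc in \<open>auto intro: set_update_memI\<close>)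
  have mixed: "mixed_brk half_alg ds ?xs i (snd (ps ! i)) = res (brk L (?xs[i := \<tau> (us ! i)]))"
    if i: "i < n" for i
  proof -
    have "homogeneous (part L) ds (?xs[i := us ! i])"
      using homogeneous_update[OF hom homogeneous_nth[OF us], of i i] i len by simp
    then show ?thesis using mixed_brk_res[of ds ?xs i "us ! i"] i xs ps by simp
  qed
  have "Tstar_brk_hom half_alg half_cocycle ds ps =
      (\<sigma> (brk L ?xs), res (brk L ?xs) + (\<Sum>i<n. res (brk L (?xs[i := \<tau> (us ! i)]))))"
    using mixed ps by (simp add: Tstar_brk_hom_def fst half_cocycle_def)
  also have "\<dots> = emb (brk L ?xs + (\<Sum>i<n. brk L (?xs[i := \<tau> (us ! i)])))"
  proof -
    let ?Z = "\<Sum>i<n. brk L (?xs[i := \<tau> (us ! i)])"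
    have "?Z \<in> carrier L" by (rule subspace_sum[OF subspace_carrier]) (use Z in auto)
    moreover have "\<sigma> ?Z = 0" by (subst \<sigma>_sum) (use Z \<sigma>0 in auto)
    moreover have "res ?Z = (\<Sum>i<n. res (brk L (?xs[i := \<tau> (us ! i)])))"
      by (rule res_sum) (use Z in auto)
    ultimately show ?thesis using b by (simp add: emb_def \<sigma>_add res_add)
  qed
  finally show ?thesis .
qed

lemma T_brk_emb_homogeneous:
  assumes "homogeneous (part L) ds xs" "length xs = n"
  shows "Tstar_brk_hom half_alg half_cocycle ds (map emb xs) = emb (brk L xs)"
  using T_brk_homogeneous[OF assms assms(1), of "map emb xs"] assms
    brk_expand_\<sigma>\<tau>[OF homogeneous_carrier[OF assms(1)] assms(2)]
  by (simp add: emb_def)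

lemma T_brk: "brk T ps = (\<Sum>ds\<in>{ds. length ds = n}.
    Tstar_brk_hom half_alg half_cocycle ds (map2 T.comp ds ps))"
  by (simp add: Tstar_def)

lemma T_brk_emb:
  assumes "set xs \<subseteq> carrier L" "length xs = n"
  shows "emb (brk L xs) = brk T (map emb xs)"
proof -
  have hom: "homogeneous (part L) ds (map2 comp ds xs)" "length (map2 comp ds xs) = n" if "length ds = n" for ds
    using homogeneous_components[OF assms(1), of ds] assms(2) that by simp_all
  have "map2 T.comp ds (map emb xs) = map emb (map2 comp ds xs)" if "length ds = n" for ds
  proof (rule nth_equalityI)
    fix i assume "i < length (map2 T.comp ds (map emb xs))"
    then show "map2 T.comp ds (map emb xs) ! i = map emb (map2 comp ds xs) ! i"
      using assms that nth_mem[of i xs] by (auto simp: emb_component subset_iff)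
  qed (use assms that in simp)
  then have "brk T (map emb xs) = (\<Sum>ds\<in>{ds. length ds = n}. emb (brk L (map2 comp ds xs)))"
    unfolding T_brk using T_brk_emb_homogeneous[OF hom] by (intro sum.cong) auto
  also have "\<dots> = emb (\<Sum>ds\<in>{ds. length ds = n}. brk L (map2 comp ds xs))"
    by (rule emb_sum[symmetric], rule brk_carrier, rule homogeneous_carrier[OF hom(1)]) (use hom in auto)
  finally show ?thesis using brk_expand[OF assms] by simp
qed

lemma T_brk_range:
  assumes "set ps \<subseteq> carrier T" "length ps = n"
  shows "brk T ps \<in> emb ` carrier L"
proof -
  have "\<exists>z\<in>carrier L. Tstar_brk_hom half_alg half_cocycle ds (map2 T.comp ds ps) = emb z"
    if ds: "length ds = n" for ds
  proof -
    let ?ps = "map2 T.comp ds ps"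
    have hom: "homogeneous (part T) ds ?ps" "length ?ps = n"
      using T.homogeneous_components[OF assms(1), of ds] ds assms(2) by simp_all
    have "\<forall>i. \<exists>x u. i < n \<longrightarrow> x \<in> part L (ds ! i) \<and> u \<in> part L (ds ! i) \<and> ?ps ! i = (\<sigma> x, res u)"
      using T_element homogeneous_nth[OF hom(1)] hom(2) by metis
    then obtain X U where XU: "\<And>i. i < n \<Longrightarrow> X i \<in> part L (ds ! i)" "\<And>i. i < n \<Longrightarrow> U i \<in> part L (ds ! i)"
      "\<And>i. i < n \<Longrightarrow> ?ps ! i = (\<sigma> (X i), res (U i))" by metis
    let ?xs = "map X [0..<n]" and ?us = "map U [0..<n]"
    have homs: "homogeneous (part L) ds ?xs" "homogeneous (part L) ds ?us"
      using XU(1,2) ds by (auto intro!: homogeneousI)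
    have "Tstar_brk_hom half_alg half_cocycle ds ?ps =
        emb (brk L (map \<sigma> ?xs) + (\<Sum>i<n. brk L ((map \<sigma> ?xs)[i := \<tau> (?us ! i)])))"
      by (rule T_brk_homogeneous[OF homs(1) _ homs(2) hom(2)]) (use XU(3) in auto)
    moreover have "brk L (map \<sigma> ?xs) + (\<Sum>i<n. brk L ((map \<sigma> ?xs)[i := \<tau> (?us ! i)])) \<in> carrier L"
    proof -
      have C: "set (map \<sigma> ?xs) \<subseteq> carrier L"
        by (rule homogeneous_carrier[OF homogeneous_map[OF homs(1) \<sigma>_part]])
      have uc: "?us ! i \<in> carrier L" if "i < n" for i
        using that XU(2)[THEN part_carrier] by simp
      have "brk L ((map \<sigma> ?xs)[i := \<tau> (?us ! i)]) \<in> carrier L" if "i < n" for i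
        by (rule brk_carrier[OF set_update_carrier[OF C \<tau>_carrier[OF uc[OF that]]]]) simp
      then show ?thesis using brk_carrier[OF C] by (intro carrier_closed) auto
    qed
    ultimately show ?thesis by blast
  qed
  then obtain Z where Z: "\<And>ds. length ds = n \<Longrightarrow> Z ds \<in> carrier L"
    "\<And>ds. length ds = n \<Longrightarrow> Tstar_brk_hom half_alg half_cocycle ds (map2 T.comp ds ps) = emb (Z ds)"
    by metis
  have "brk T ps = (\<Sum>ds\<in>{ds. length ds = n}. emb (Z ds))"
    unfolding T_brk using Z(2) by (intro sum.cong) auto
  also have "\<dots> = emb (\<Sum>ds\<in>{ds. length ds = n}. Z ds)"
    using Z(1) by (intro emb_sum[symmetric]) auto
  finally show ?thesis using Z(1) by (auto intro!: imageI)
qed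

text \<open>
  Only the sign in the definition of the form has to be absorbed by supersymmetry; then
  \<open>\<sigma>_half\<close> applies to each pair of components.
\<close>

lemma T_form_emb:
  assumes "x \<in> carrier L" "y \<in> carrier L"
  shows "Tstar_form half_alg (emb x) (emb y) = B x y"
proof -
  have "Tstar_form half_alg (emb x) (emb y) =
      (\<Sum>d\<in>UNIV. \<Sum>e\<in>UNIV. res (comp d x) (\<sigma> (comp e y)) + sg (d * e) * res (comp e y) (\<sigma> (comp d x)))"
    using emb_component assms unfolding Tstar_form_def T_simps by (simp add: emb_def)
  also have "\<dots> = (\<Sum>d\<in>UNIV. \<Sum>e\<in>UNIV. B (comp d x) (comp e y))"
  proof (intro sum.cong refl)
    fix d e
    have p: "comp d x \<in> part L d" "comp e y \<in> part L e" using assms by (auto simp: component_part)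
    have "B (\<sigma> (comp d x)) (comp e y) = sg (d * e) * B (comp e y) (\<sigma> (comp d x))"
      by (rule B_supersymmetric[OF \<sigma>_part[OF p(1)] p(2)])
    then show "res (comp d x) (\<sigma> (comp e y)) + sg (d * e) * res (comp e y) (\<sigma> (comp d x)) = B (comp d x) (comp e y)"
      using \<sigma>_half[of "comp d x" "comp e y"] assms by (simp add: res_def half_carrier add.commute)
  qed
  also have "\<dots> = B x y"
    using assms by (simp add: component_sum flip: B_sum_left B_sum_right)
  finally show ?thesis .
qed

text \<open>
  The elements of the extension are the pairs \<open>(\<sigma> x, res u)\<close>. To bring \<open>u\<close> and \<open>x\<close> together one can
  only change \<open>x\<close> by the kernel of \<open>\<sigma>\<close> and \<open>u\<close> by the kernel of \<open>\<tau>\<close>, so the cokernel of \<open>emb\<close> is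
  measured by \<open>\<sigma> (\<tau> (u - x))\<close>.
\<close>

lemma emb_surjective_at:
  assumes "x \<in> carrier L" "u \<in> carrier L" "\<sigma> (\<tau> (u - x)) = 0"
  shows "(\<sigma> x, res u) = emb (x + \<tau> (u - x))"
proof -
  define i where "i = \<tau> (u - x)"
  have i: "\<sigma> i = 0" "i \<in> carrier L" using assms by (simp_all add: i_def)
  moreover have "i = (u - x) - (\<sigma> u - \<sigma> x)"
    using assms(1,2) by (simp add: i_def \<tau>_def \<sigma>_diff)
  moreover from i have "\<tau> (x + i) = x + i - \<sigma> x"
    using assms(1) by (simp add: \<tau>_def \<sigma>_add)
  ultimately have "\<tau> (x + i) = \<tau> u" by (simp add: \<tau>_def)
  then have "\<tau> (x + \<tau> (u - x)) = \<tau> u" by (simp add: i_def)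
  then show ?thesis
    using assms res_eq_iff[of "x + \<tau> (u - x)" u] by (simp add: emb_def \<sigma>_add)
qed

lemma T_carrier_element:
  assumes "p \<in> carrier T"
  obtains x u where "x \<in> carrier L" "u \<in> carrier L" "p = (\<sigma> x, res u)"
proof -
  obtain q r where "q \<in> part T 0" "r \<in> part T 1" "p = q + r"
    using assms unfolding whole_def by auto
  then obtain x u y v where "x \<in> part L 0" "u \<in> part L 0" "q = (\<sigma> x, res u)"
    "y \<in> part L 1" "v \<in> part L 1" "r = (\<sigma> y, res v)"
    by (elim T_element)
  then show ?thesis
    using that[of "x + y" "u + v"] \<open>p = q + r\<close> by (simp add: \<sigma>_add res_add part_carrier)
qed

lemma emb_part_image: "emb ` part L d = part T d \<inter> emb ` carrier L"
proof (intro equalityI subsetI)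
  fix p assume "p \<in> part T d \<inter> emb ` carrier L"
  then obtain x where x: "x \<in> carrier L" "p = emb x" "p \<in> part T d" by auto
  then have "p = emb (comp d x)" using emb_component[of x d] T.component_same by simp
  then show "p \<in> emb ` part L d" using x component_part by auto
qed (auto simp: emb_part part_carrier)

text \<open>
  The target \<open>M\<close> is left open because this serves both the extension itself, when \<open>emb\<close> is onto, and
  its ideal \<open>emb ` carrier L\<close>.
\<close>

lemma emb_isometry:
  "part M = (\<lambda>d. part T d \<inter> emb ` carrier L) \<Longrightarrow> scal M = scal T \<Longrightarrow> brk M = brk T \<Longrightarrow>
     isometric n L B M (Tstar_form half_alg)"
  unfolding isometric_def
proof (intro exI[of _ emb] conjI allI impI ballI)
  assume M: "part M = (\<lambda>d. part T d \<inter> emb ` carrier L)" "scal M = scal T" "brk M = brk T"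
  show part: "emb ` part L d = part M d" for d using emb_part_image M by simp
  have "carrier M = emb ` carrier L"
  proof (intro equalityI subsetI)
    fix p assume "p \<in> carrier M"
    then obtain x y where "x \<in> part L 0" "y \<in> part L 1" "p = emb x + emb y"
      unfolding whole_def part[symmetric] by blast
    then have "p = emb (x + y)" "x + y \<in> carrier L" by (auto simp: emb_add part_carrier)
    then show "p \<in> emb ` carrier L" by blast
  next
    fix p assume "p \<in> emb ` carrier L"
    then obtain x where x: "x \<in> carrier L" "p = emb x" by auto
    then have "p = emb (comp 0 x) + emb (comp 1 x)" using component_split[of x] by (simp flip: emb_add)
    then show "p \<in> carrier M" unfolding whole_def part[symmetric] using component_part[OF x(1)] by blast
  qed
  then show "bij_betw emb (carrier L) (carrier M)"
    by (auto simp: bij_betw_def inj_on_def emb_eq_iff)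
  show "linear_map_on (carrier L) (scal L) (scal M) emb" using emb_linear M by simp
  show "emb (brk L xs) = brk M (map emb xs)" if "set xs \<subseteq> carrier L \<and> length xs = n" for xs
    using T_brk_emb that M by auto
  show "Tstar_form half_alg (emb x) (emb y) = B x y" if "x \<in> carrier L" "y \<in> carrier L" for x y
    using T_form_emb that .
qed

lemma isometric_Tstar:
  assumes "\<And>x. x \<in> carrier L \<Longrightarrow> \<sigma> (\<tau> x) = 0"
  shows "isometric n L B T (Tstar_form half_alg)"
proof -
  have "part T d \<subseteq> emb ` carrier L" for d
  proof
    fix p assume "p \<in> part T d"
    then obtain x u where xu: "x \<in> carrier L" "u \<in> carrier L" "p = (\<sigma> x, res u)"
      using T_carrier_element T.part_carrier by metis
    then have "p = emb (x + \<tau> (u - x))" using emb_surjective_at[of x u] assms by simp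
    then show "p \<in> emb ` carrier L" using xu by blast
  qed
  then show ?thesis by (intro emb_isometry) auto
qed

lemma emb_image_subspace: "T.subspace (emb ` carrier L)"
proof (rule T.subspaceI)
  show "0 \<in> emb ` carrier L" using imageI[OF carrier_closed(1), of emb] by simp
next
  fix p q assume "p \<in> emb ` carrier L" "q \<in> emb ` carrier L"
  then obtain x y where "x \<in> carrier L" "y \<in> carrier L" "p = emb x" "q = emb y" by blast
  then have "p + q = emb (x + y)" "x + y \<in> carrier L" by (auto simp: emb_add)
  then show "p + q \<in> emb ` carrier L" by blast
next
  fix c p assume "p \<in> emb ` carrier L"
  then obtain x where "x \<in> carrier L" "p = emb x" by blast
  then have "scal T c p = emb (scal L c x)" "scal L c x \<in> carrier L" by (auto simp: emb_scale)
  then show "scal T c p \<in> emb ` carrier L" by blast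
qed

lemma emb_image_carrier: "carrier (restrict_to T (emb ` carrier L)) = emb ` carrier L"
proof -
  have eq: "carrier (restrict_to T I) = {x + y | x y. x \<in> part T 0 \<inter> I \<and> y \<in> part T 1 \<inter> I}" for I
    by (simp add: whole_def restrict_to_def)
  show ?thesis
  proof (intro equalityI subsetI)
    fix p assume "p \<in> carrier (restrict_to T (emb ` carrier L))"
    then obtain q r where "q \<in> emb ` carrier L" "r \<in> emb ` carrier L" "p = q + r"
      unfolding eq by blast
    then show "p \<in> emb ` carrier L"
      using T.subspace_add[OF emb_image_subspace] by blast
  next
    fix p assume "p \<in> emb ` carrier L"
    then obtain x where x: "x \<in> carrier L" "p = emb x" by auto
    then have "p = emb (comp 0 x) + emb (comp 1 x)" using component_split[of x] by (simp flip: emb_add)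
    moreover have "emb (comp d x) \<in> part T d \<inter> emb ` carrier L" for d
      using x emb_part component_part by auto
    ultimately show "p \<in> carrier (restrict_to T (emb ` carrier L))"
      unfolding eq by blast
  qed
qed

text \<open>
  An ideal because it contains all brackets; nondegenerate because \<open>emb\<close> is isometric and \<open>B\<close> is
  nondegenerate.
\<close>

lemma emb_image_nondegenerate_ideal:
  "nondegenerate_ideal n T (Tstar_form half_alg) (emb ` carrier L)"
  unfolding nondegenerate_ideal_def graded_ideal_def
proof (intro conjI allI impI)
  show "module.subspace (scal T) (emb ` carrier L)" by (rule emb_image_subspace)
  show "emb ` carrier L = carrier (restrict_to T (emb ` carrier L))" by (rule emb_image_carrier[symmetric])
  show "brk T ps \<in> emb ` carrier L"
    if "set ps \<subseteq> carrier T \<and> length ps = n \<and> set ps \<inter> emb ` carrier L \<noteq> {}" for ps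
    using T_brk_range that by blast
  have zero: "p = 0" if p: "p \<in> emb ` carrier L" "\<forall>q\<in>emb ` carrier L. Tstar_form half_alg p q = 0" for p
  proof -
    obtain x where x: "x \<in> carrier L" "p = emb x" using p by auto
    have "B x y = 0" if "y \<in> carrier L" for y
      using bspec[OF p(2) imageI[OF that, of emb]] T_form_emb[OF x(1) that] x(2) by simp
    then have "x = 0" by (rule B_nondegenerate[OF x(1)])
    then show "p = 0" using x by simp
  qed
  have "Tstar_form half_alg 0 q = 0" if q: "q \<in> emb ` carrier L" for q
  proof -
    obtain y where y: "y \<in> carrier L" "q = emb y" using q by blast
    have "Tstar_form half_alg (emb 0) (emb y) = B 0 y"
      by (rule T_form_emb[OF _ y(1)]) simp
    then show ?thesis unfolding emb_zero B_zero_left[OF y(1)] y(2) .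
  qed
  then show "nondegenerate (restrict_to T (emb ` carrier L)) (Tstar_form half_alg)"
    unfolding nondegenerate_def emb_image_carrier
    using T.subspace_0[OF emb_image_subspace] zero by blast
qed

text \<open>
  The functional \<open>res w\<close> alone spans a complement of the image, by \<open>emb_surjective_at\<close>.
\<close>

lemma emb_image_codimension_one:
  assumes w: "w \<in> carrier L" "\<sigma> (\<tau> w) \<noteq> 0"
    and gen: "\<And>v. v \<in> carrier L \<Longrightarrow> \<exists>c. \<sigma> (\<tau> (v - scal L c w)) = 0"
  shows "codimension_one T (emb ` carrier L)"
proof -
  define q where "q = (0 :: 'a, res w)"
  let ?I = "emb ` carrier L"
  have q: "q \<in> carrier T"
  proof -
    have "q = (0, res (comp 0 w)) + (0, res (comp 1 w))"
      using w component_split[of w] by (simp add: q_def flip: res_add)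
    moreover have "(0, res (comp d w)) \<in> part T d" for d
      using w res_dual[OF component_part[of w d]] H.zero_part[of d] by (auto simp: T_simps Tstar_part_def)
    ultimately show ?thesis unfolding whole_def by blast
  qed
  have IT: "?I \<subseteq> carrier T" using emb_carrier by auto
  have qI: "q \<notin> ?I"
  proof
    assume "q \<in> ?I"
    then obtain x where x: "x \<in> carrier L" "\<sigma> x = 0" "res x = res w" by (auto simp: q_def emb_def)
    then have "x = \<tau> w" using res_eq_iff[OF x(1) w(1)] by (simp add: \<tau>_def)
    then show False using x(2) w(2) by simp
  qed
  obtain Bs where Bs: "Bs \<subseteq> ?I" "T.independent Bs" "?I \<subseteq> T.span Bs" "card Bs = T.dim ?I"
    using T.basis_exists by metis
  have span: "T.span Bs = ?I"
    using T.span_minimal[OF Bs(1) emb_image_subspace] Bs(3) by auto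
  have finite: "finite Bs"
  proof -
    obtain U where U: "finite U" "span U = carrier L" using finite_dim by (auto simp: finite_dimensional_def)
    have "?I \<subseteq> T.span (emb ` U)"
    proof
      fix p assume "p \<in> ?I"
      then obtain x where x: "x \<in> carrier L" "p = emb x" by blast
      then have "x \<in> span U" using U by simp
      then have "x \<in> carrier L \<and> emb x \<in> T.span (emb ` U)"
      proof (induction rule: span_induct_alt)
        case base
        then show ?case by (simp add: T.span_zero)
      next
        case (step c x y)
        moreover have "x \<in> carrier L" using step U span_base by auto
        ultimately show ?case
          by (simp add: emb_add emb_scale T.span_add T.span_scale T.span_base)
      qed
      then show "p \<in> T.span (emb ` U)" using x by simp
    qed
    then show ?thesis
      using T.independent_span_bound[OF _ Bs(2), of "emb ` U"] U Bs(1) by blast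
  qed
  have "T.dim (carrier T) = card (insert q Bs)"
  proof (rule T.dim_unique)
    show "insert q Bs \<subseteq> carrier T" using q Bs(1) IT by auto
    show "T.independent (insert q Bs)" using Bs(2) qI span by (intro T.independent_insertI) auto
    show "carrier T \<subseteq> T.span (insert q Bs)"
    proof
      fix p assume "p \<in> carrier T"
      then obtain x u where xu: "x \<in> carrier L" "u \<in> carrier L" "p = (\<sigma> x, res u)"
        by (rule T_carrier_element)
      obtain c where c: "\<sigma> (\<tau> ((u - x) - scal L c w)) = 0" using gen[of "u - x"] xu by auto
      have "p - scal T c q = (\<sigma> x, res (u - scal L c w))"
        using xu w by (simp add: q_def T_simps Tstar_scal_def res_diff res_scale)
      also have "\<dots> = emb (x + \<tau> ((u - scal L c w) - x))"
        using xu w c by (intro emb_surjective_at) (auto simp: algebra_simps)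
      finally have "p - scal T c q \<in> ?I" using xu w by blast
      then show "p \<in> T.span (insert q Bs)" unfolding T.span_insert span by auto
    qed
  qed simp
  also have "card (insert q Bs) = Suc (card Bs)" using finite Bs(1) qI by (intro card_insert_disjoint) auto
  finally show ?thesis using IT Bs(4) by (simp add: codimension_one_def)
qed

lemma isometric_restricted: "isometric n L B (restrict_to T (emb ` carrier L)) (Tstar_form half_alg)"
  by (rule emb_isometry) (auto simp: restrict_to_def)

end

section \<open>Maximal isotropic ideals\<close>

context graded_vector_space
begin

text \<open>
  The projection onto \<open>I\<close> is chosen in each degree separately, which makes it even.
\<close>

lemma graded_projection:
  assumes I: "subspace I" "graded_subset I"
  shows "\<exists>\<pi>. even_map \<pi> \<and> (\<forall>x\<in>I. \<pi> x = 0) \<and> (\<forall>x\<in>carrier L. x - \<pi> x \<in> I)"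
proof -
  interpret P: vector_space_pair "scal L" "scal L" ..
  have "\<exists>g. range g \<subseteq> part L d \<inter> I \<and> Vector_Spaces.linear (scal L) (scal L) g \<and> (\<forall>v\<in>part L d \<inter> I. g v = v)" for d
    using P.linear_exists_left_inverse_on[of "\<lambda>x. x" "part L d \<inter> I"] linear_ident
      subspace_inter[OF subspace_part I(1)] by auto
  then obtain g where g: "\<And>d x. g d x \<in> part L d \<inter> I"
    "\<And>d. Vector_Spaces.linear (scal L) (scal L) (g d)" "\<And>d v. v \<in> part L d \<inter> I \<Longrightarrow> g d v = v"
    by (metis rangeI subsetD)
  have gadd: "g d (x + y) = g d x + g d y" and gscale: "g d (scal L c x) = scal L c (g d x)" for d x y c
    using g(2)[of d] by (simp_all add: Vector_Spaces.linear_iff)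
  have g0: "g d 0 = 0" for d using gscale[of d 0 0] by simp
  define \<rho> where "\<rho> x = g 0 (comp 0 x) + g 1 (comp 1 x)" for x
  have \<rho>I: "\<rho> x \<in> I" for x unfolding \<rho>_def using g(1) subspace_add[OF I(1)] by blast
  have \<rho>_part: "\<rho> x = g d x" if "x \<in> part L d" for x d
    using that bit_cases[of d] by (auto simp: \<rho>_def component_same component_other g0)
  have \<rho>_id: "\<rho> x = x" if "x \<in> I" for x
    using that g(3) I(2) component_part[of x] component_split[of x]
    by (simp add: \<rho>_def graded_subsetD)
  show ?thesis
  proof (intro exI[of _ "\<lambda>x. x - \<rho> x"] conjI ballI)
    show "even_map (\<lambda>x. x - \<rho> x)"
      unfolding even_map_def
    proof (intro conjI allI ballI)
      show "linear_map_on (carrier L) (scal L) (scal L) (\<lambda>x. x - \<rho> x)"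
        by (auto simp: linear_map_on_def \<rho>_def component_add component_scale gadd gscale
            scale_right_diff_distrib scale_right_distrib)
      show "x - \<rho> x \<in> part L d" if "x \<in> part L d" for d x
        using g(1) that by (simp add: \<rho>_part subspace_diff[OF subspace_part])
    qed
  qed (use \<rho>I \<rho>_id in auto)
qed

end

context metric_n_lie_space
begin

text \<open>
  The two signs from exchanging the arguments of \<open>B\<close> cancel, because \<open>f\<close> and \<open>g\<close> preserve degrees.
\<close>

lemma B_adjoint_swap:
  assumes f: "even_map f" and g: "even_map g"
    and adj: "\<And>x y. x \<in> carrier L \<Longrightarrow> y \<in> carrier L \<Longrightarrow> B (g x) y = B x (f y)"
    and x: "x \<in> carrier L" and y: "y \<in> carrier L"
  shows "B (f x) y = B x (g y)"
proof -
  have "B (f (comp d x)) (comp d y) = B (comp d x) (g (comp d y))" for d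
  proof -
    note p = component_part[OF x, of d] component_part[OF y, of d]
    have "B (f (comp d x)) (comp d y) = sg (d * d) * B (comp d y) (f (comp d x))"
      by (rule B_supersymmetric[OF even_mapD(3)[OF f p(1)] p(2)])
    also have "B (comp d y) (f (comp d x)) = B (g (comp d y)) (comp d x)"
      using x y by (simp add: adj)
    also have "sg (d * d) * \<dots> = B (comp d x) (g (comp d y))"
      by (rule B_supersymmetric[OF p(1) even_mapD(3)[OF g p(2)], symmetric])
    finally show ?thesis .
  qed
  then show ?thesis
    using x y even_map_carrier[OF f x] even_map_carrier[OF g y]
    by (simp add: B_components[of "f x" y] B_components[of x "g y"] even_map_component[OF f] even_map_component[OF g])
qed

lemma brk_last_add: "set xs \<subseteq> carrier L \<Longrightarrow> length xs = n - 1 \<Longrightarrow> x \<in> carrier L \<Longrightarrow> y \<in> carrier L \<Longrightarrow>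
    brk L (xs @ [x + y]) = brk L (xs @ [x]) + brk L (xs @ [y])"
  and brk_last_scale: "set xs \<subseteq> carrier L \<Longrightarrow> length xs = n - 1 \<Longrightarrow> x \<in> carrier L \<Longrightarrow>
    brk L (xs @ [scal L c x]) = scal L c (brk L (xs @ [x]))"
  using multilinear_onD[OF brk_multilinear, of xs "[]"] n_pos by auto

definition brk_closed :: "'a set \<Rightarrow> bool" where
  "brk_closed X \<longleftrightarrow> (\<forall>xs. \<forall>y\<in>X. set xs \<subseteq> carrier L \<and> length xs = n - 1 \<longrightarrow> brk L (xs @ [y]) \<in> X)"

definition isotropic_ideal :: "'a set \<Rightarrow> bool" where
  "isotropic_ideal I \<longleftrightarrow> subspace I \<and> graded_subset I \<and> brk_closed I \<and> (\<forall>x\<in>I. \<forall>y\<in>I. B x y = 0)"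

lemma isotropic_idealD:
  assumes "isotropic_ideal I"
  shows "subspace I" "graded_subset I" "brk_closed I" "x \<in> I \<Longrightarrow> y \<in> I \<Longrightarrow> B x y = 0"
  using assms by (auto simp: isotropic_ideal_def)

lemma lc_isotropic_ideal: "lc k = {0} \<Longrightarrow> k \<le> m + m \<Longrightarrow> isotropic_ideal (lc m)"
  using lc_subspace lc_graded lc_orthogonal[of k m m] brk_lc[THEN subsetD[OF lc_Suc_subset]]
  by (simp add: isotropic_ideal_def brk_closed_def)

text \<open>
  The conditions on an isotropic ideal concern at most two of its elements at a time, so they pass
  to unions of chains.
\<close>

lemma maximal_isotropic_ideal_exists:
  assumes I0: "isotropic_ideal I0"
  shows "\<exists>I. isotropic_ideal I \<and> I0 \<subseteq> I \<and> (\<forall>I'. isotropic_ideal I' \<longrightarrow> I \<subseteq> I' \<longrightarrow> I' = I)"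
proof -
  let ?A = "{I. isotropic_ideal I \<and> I0 \<subseteq> I}"
  have "\<exists>M\<in>?A. \<forall>X\<in>?A. M \<subseteq> X \<longrightarrow> X = M"
  proof (rule subset_Zorn_nonempty)
    show "?A \<noteq> {}" using I0 by auto
    fix C assume C: "C \<noteq> {}" "subset.chain ?A C"
    have iso: "isotropic_ideal I" if "I \<in> C" for I
      using C(2) that by (auto simp: subset_chain_def)
    have common: "\<exists>I\<in>C. x \<in> I \<and> y \<in> I" if xy: "x \<in> \<Union>C" "y \<in> \<Union>C" for x y
    proof -
      obtain X Y where "X \<in> C" "x \<in> X" "Y \<in> C" "y \<in> Y" using xy by auto
      then show ?thesis using C(2) unfolding subset_chain_def by blast
    qed
    have "isotropic_ideal (\<Union>C)"
      unfolding isotropic_ideal_def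
    proof (intro conjI ballI)
      show "subspace (\<Union>C)"
      proof (rule subspaceI)
        obtain I where "I \<in> C" using C(1) by auto
        then show "0 \<in> \<Union>C" using subspace_0[OF isotropic_idealD(1)[OF iso]] by blast
      next
        fix x y assume "x \<in> \<Union>C" "y \<in> \<Union>C"
        then obtain I where I: "I \<in> C" "x \<in> I" "y \<in> I" using common by blast
        then show "x + y \<in> \<Union>C" using subspace_add[OF isotropic_idealD(1)[OF iso[OF I(1)]]] by blast
      next
        fix c x assume "x \<in> \<Union>C"
        then obtain I where I: "I \<in> C" "x \<in> I" by blast
        then show "scal L c x \<in> \<Union>C" using subspace_scale[OF isotropic_idealD(1)[OF iso[OF I(1)]]] by blast
      qed
      show "graded_subset (\<Union>C)"
        using isotropic_idealD(2)[OF iso] unfolding graded_subset_def by blast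
      show "brk_closed (\<Union>C)"
        using isotropic_idealD(3)[OF iso] unfolding brk_closed_def by blast
      fix x y assume "x \<in> \<Union>C" "y \<in> \<Union>C"
      then obtain I where "I \<in> C" "x \<in> I" "y \<in> I" using common by blast
      then show "B x y = 0" using isotropic_idealD(4)[OF iso] by blast
    qed
    moreover obtain I where "I \<in> C" using C(1) by auto
    then have "I0 \<subseteq> \<Union>C" using C(2) unfolding subset_chain_def by blast
    ultimately show "\<Union>C \<in> ?A" by simp
  qed
  then obtain M where M: "M \<in> ?A" "\<forall>X\<in>?A. M \<subseteq> X \<longrightarrow> X = M" by (rule bexE)
  have "I' = M" if "isotropic_ideal I'" "M \<subseteq> I'" for I'
    using M that subset_trans[of I0 M I'] by simp
  then show ?thesis using M(1) by (intro exI[of _ M]) simp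
qed

end

context finite_metric_n_lie_space
begin

lemma adjoint_exists:
  assumes f: "even_map f"
  shows "\<exists>g. even_map g \<and> (\<forall>x\<in>carrier L. \<forall>y\<in>carrier L. B (g x) y = B x (f y))"
proof -
  note fC = even_map_carrier[OF f]
  have "\<exists>u\<in>carrier L. \<forall>y\<in>carrier L. B x (f y) = B u y" if x: "x \<in> carrier L" for x
    by (rule functional_represented[OF subspace_carrier order_refl])
      (use x in \<open>auto simp: linear_map_on_def even_mapD[OF f] fC B_add_right B_scale_right\<close>)
  then obtain g where g: "\<And>x. x \<in> carrier L \<Longrightarrow> g x \<in> carrier L"
    "\<And>x y. x \<in> carrier L \<Longrightarrow> y \<in> carrier L \<Longrightarrow> B (g x) y = B x (f y)"
    by metis
  have "even_map g"
    unfolding even_map_def linear_map_on_def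
  proof (intro conjI ballI allI)
    show "g (x + y) = g x + g y" if "x \<in> carrier L" "y \<in> carrier L" for x y
      using that by (intro B_eqI) (auto simp: g B_add_left fC)
    show "g (scal L c x) = scal L c (g x)" if "x \<in> carrier L" for c x
      using that by (intro B_eqI) (auto simp: g B_scale_left fC)
    fix d x assume x: "x \<in> part L d"
    have xC: "x \<in> carrier L" using x by (rule part_carrier)
    have "comp d (g x) = g x"
    proof (rule B_eqI)
      fix y assume y: "y \<in> carrier L"
      have "B (comp d (g x)) y = B (comp d (g x)) (comp d y)"
        using y g xC by (simp add: B_component_right component_part)
      also have "\<dots> = B x (f (comp d y))"
        using y g xC by (simp add: B_component_left component_part)
      also have "\<dots> = B x (f y)"
        using y x fC by (simp add: B_component_right flip: even_map_component[OF f])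
      finally show "B (comp d (g x)) y = B (g x) y" using g xC y by simp
    qed (use g xC in auto)
    then show "g x \<in> part L d" using component_part[OF g(1)[OF xC], of d] by simp
  qed
  then show ?thesis using g by blast
qed

end

locale maximal_isotropic_ideal = finite_metric_n_lie_space n L B
  for n and L :: "('k::alg_closed_field, 'a::ab_group_add) super_alg" and B +
  fixes I :: "'a set"
  assumes two: "(2::'k) \<noteq> 0" and lc_vanishes: "\<exists>k. lc k = {0}"
    and isotropic: "isotropic_ideal I"
    and maximal: "\<And>I'. isotropic_ideal I' \<Longrightarrow> I \<subseteq> I' \<Longrightarrow> I' = I"
begin

lemma I_subspace: "subspace I" and I_graded: "graded_subset I" and I_closed: "brk_closed I"
  and I_isotropic: "x \<in> I \<Longrightarrow> y \<in> I \<Longrightarrow> B x y = 0"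
  using isotropic by (auto simp: isotropic_ideal_def)

lemma I_carrier: "x \<in> I \<Longrightarrow> x \<in> carrier L"
  using I_graded by (rule graded_subsetD(1))

definition perp :: "'a set" where
  "perp = {x \<in> carrier L. \<forall>y\<in>I. B x y = 0}"

lemma perpD: "x \<in> perp \<Longrightarrow> x \<in> carrier L" "x \<in> perp \<Longrightarrow> y \<in> I \<Longrightarrow> B x y = 0"
  by (auto simp: perp_def)

lemma I_perp: "I \<subseteq> perp"
  using I_isotropic I_carrier by (auto simp: perp_def)

lemma perp_subspace: "subspace perp"
  unfolding perp_def by (rule subspaceI) (auto simp: B_add_left B_scale_left I_carrier)

lemma perp_graded: "graded_subset perp"
  unfolding graded_subset_def
proof (intro conjI ballI allI)
  fix x d assume x: "x \<in> perp"
  have "B (comp d x) y = 0" if y: "y \<in> I" for y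
  proof -
    have "B (comp d x) y = B (comp d x) (comp d y)"
      using x y perpD I_carrier by (simp add: B_component_right component_part)
    also have "\<dots> = B x (comp d y)"
      using x y perpD I_carrier by (simp add: B_component_left component_part)
    also have "\<dots> = 0" using x graded_subsetD(2)[OF I_graded y] by (rule perpD(2))
    finally show ?thesis .
  qed
  then show "comp d x \<in> perp" using x by (auto simp: perp_def)
qed (auto simp: perp_def)

lemma I_orthogonal_perp:
  assumes x: "x \<in> perp" and y: "y \<in> I" shows "B y x = 0"
proof -
  have "B (comp d y) (comp d x) = 0" for d
  proof -
    have "B (comp d y) (comp d x) = sg (d * d) * B (comp d x) (comp d y)"
      using x y perpD I_carrier by (intro B_supersymmetric component_part) auto
    also have "B (comp d x) (comp d y) = 0"
      by (rule perpD(2)[OF graded_subsetD(2)[OF perp_graded x] graded_subsetD(2)[OF I_graded y]])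
    finally show ?thesis by simp
  qed
  then show ?thesis using x y perpD I_carrier by (simp add: B_components[of y x])
qed

lemma perp_closed: "brk_closed perp"
  unfolding brk_closed_def
proof (intro allI ballI impI)
  fix xs y assume y: "y \<in> perp" and xs: "set xs \<subseteq> carrier L \<and> length xs = n - 1"
  have "B (brk L (xs @ [y])) z = 0" if "z \<in> I" for z
  proof (rule brk_orthogonal[OF perp_graded I_graded _ y _ _ that])
    fix x' xs' y' assume "x' \<in> perp" "set xs' \<subseteq> carrier L" "length xs' = n - 1" "y' \<in> I"
    then show "B x' (brk L (xs' @ [y'])) = 0"
      using I_closed perpD(2) unfolding brk_closed_def by blast
  qed (use xs in auto)
  moreover have "brk L (xs @ [y]) \<in> carrier L" using xs y perpD(1) by (intro brk_carrier_last) auto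
  ultimately show "brk L (xs @ [y]) \<in> perp" by (simp add: perp_def)
qed

definition central_mod :: "'a \<Rightarrow> bool" where
  "central_mod w \<longleftrightarrow> (\<forall>xs. set xs \<subseteq> carrier L \<and> length xs = n - 1 \<longrightarrow> brk L (xs @ [w]) \<in> I)"

text \<open>
  Otherwise \<open>z\<close> could be adjoined to \<open>I\<close>: brackets with \<open>z\<close> fall into \<open>I\<close> anyway, and isotropy is not
  lost because \<open>z\<close> is orthogonal to \<open>I\<close> and to itself.
\<close>

lemma square_zero_mem:
  assumes z: "z \<in> perp" "z \<in> part L d" "central_mod z" "B z z = 0"
  shows "z \<in> I"
proof -
  let ?I = "span (insert z I)"
  have span_I: "span I = I" using I_subspace by simp
  have zC: "z \<in> carrier L" using z perpD by auto
  have mem: "\<exists>i\<in>I. \<exists>c. x = i + scal L c z" if x: "x \<in> ?I" for x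
  proof -
    obtain c where "x - scal L c z \<in> I" using x by (auto simp: span_insert span_I)
    then show ?thesis by (intro bexI[of _ "x - scal L c z"] exI[of _ c]) auto
  qed
  have sub: "I \<subseteq> ?I" using span_superset[of "insert z I"] by auto
  have "isotropic_ideal ?I"
    unfolding isotropic_ideal_def brk_closed_def
  proof (intro conjI ballI allI impI)
    show "subspace ?I" by simp
    show "graded_subset ?I"
    proof (rule graded_subset_span)
      fix x assume x: "x \<in> insert z I"
      then show "x \<in> carrier L" using zC I_carrier by auto
      show "comp e x \<in> ?I" for e
      proof (cases "x = z")
        case True
        then show ?thesis using z by (auto intro: graded_subset_part span_base span_zero)
      next
        case False
        then show ?thesis using x graded_subsetD(2)[OF I_graded] sub by auto
      qed
    qed
    fix x assume x: "x \<in> ?I"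
    then obtain i a where i: "i \<in> I" "x = i + scal L a z" using mem by blast
    show "B x y = 0" if y: "y \<in> ?I" for y
    proof -
      obtain j b where j: "j \<in> I" "y = j + scal L b z" using mem[OF y] by blast
      have "i \<in> carrier L" "j \<in> carrier L" using i j I_carrier by auto
      then show ?thesis
        using i j z zC I_isotropic perpD I_orthogonal_perp
        by (simp add: B_add_left B_add_right B_scale_left B_scale_right)
    qed
    fix xs :: "'a list" assume xs: "set xs \<subseteq> carrier L \<and> length xs = n - 1"
    have "brk L (xs @ [x]) = brk L (xs @ [i]) + scal L a (brk L (xs @ [z]))"
      using i zC xs I_carrier[OF i(1)] by (simp add: brk_last_add brk_last_scale)
    also have "\<dots> \<in> I"
      using xs i z(3) I_closed unfolding central_mod_def brk_closed_def
      by (intro subspace_add[OF I_subspace] subspace_scale[OF I_subspace]) auto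
    finally show "brk L (xs @ [x]) \<in> ?I" using sub by auto
  qed
  then have "?I = I" using sub by (rule maximal)
  then show ?thesis using span_base[of z "insert z I"] by auto
qed

text \<open>
  Nilpotency takes the place of Engel's theorem: descending along the lower central series there
  is a last term that meets \<open>K\<close> outside \<open>I\<close>, and brackets with vectors of \<open>K\<close> in this term lie in
  the next one, hence in \<open>I\<close>.
\<close>

lemma central_mod_exists:
  assumes K: "graded_subset K" "brk_closed K" "\<not> K \<subseteq> I"
  shows "\<exists>w d. w \<in> K \<and> w \<notin> I \<and> w \<in> part L d \<and> central_mod w"
proof -
  define r where "r = (LEAST r. K \<inter> lc r \<subseteq> I)"
  obtain k where "lc k = {0}" using lc_vanishes by blast
  then have "K \<inter> lc k \<subseteq> I" using subspace_0[OF I_subspace] by auto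
  then have r: "K \<inter> lc r \<subseteq> I" unfolding r_def by (rule LeastI)
  have "r \<noteq> 0"
  proof
    assume "r = 0"
    then have "K \<inter> carrier L \<subseteq> I" using r by simp
    then show False using K by (auto simp: graded_subset_def)
  qed
  then obtain s where s: "r = Suc s" using not0_implies_Suc by blast
  have "\<not> K \<inter> lc s \<subseteq> I" using not_less_Least[of s "\<lambda>r. K \<inter> lc r \<subseteq> I"] s unfolding r_def by auto
  then obtain x where x: "x \<in> K" "x \<in> lc s" "x \<notin> I" by blast
  have "\<exists>d. comp d x \<notin> I"
  proof (rule ccontr)
    assume "\<nexists>d. comp d x \<notin> I"
    then have "comp 0 x + comp 1 x \<in> I" by (intro subspace_add[OF I_subspace]) auto
    then show False using x component_split[OF lc_in_carrier[OF x(2)]] by simp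
  qed
  then obtain d where d: "comp d x \<notin> I" by auto
  have wK: "comp d x \<in> K" and ws: "comp d x \<in> lc s"
    using x K lc_graded by (auto simp: graded_subsetD)
  have "central_mod (comp d x)"
    unfolding central_mod_def
  proof (intro allI impI)
    fix xs assume xs: "set xs \<subseteq> carrier L \<and> length xs = n - 1"
    have "brk L (xs @ [comp d x]) \<in> lc r" using brk_lc ws xs unfolding s by blast
    moreover have "brk L (xs @ [comp d x]) \<in> K" using K(2) wK xs unfolding brk_closed_def by blast
    ultimately show "brk L (xs @ [comp d x]) \<in> I" using r by auto
  qed
  then show ?thesis using wK d component_part[OF lc_in_carrier[OF x(2)]] by blast
qed

text \<open>
  A homogeneous vector \<open>w\<close> of \<open>perp\<close> that is central modulo \<open>I\<close> but not in \<open>I\<close> has \<open>B w w \<noteq> 0\<close>, hence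
  is even, as odd vectors have square zero in characteristic other than two. The orthogonal
  complement \<open>K\<close> of \<open>w\<close> in \<open>perp\<close> is again closed under brackets. If it were not contained in \<open>I\<close>, it
  would contain a second such vector \<open>v\<close>, and over an algebraically closed field some \<open>v + c w\<close> has
  square zero and thus lies in \<open>I\<close>. Then it is orthogonal to \<open>w\<close>, so \<open>c = 0\<close> and \<open>v\<close> lies in \<open>I\<close>.
\<close>

lemma perp_dichotomy:
  "perp = I \<or> (\<exists>w. w \<in> perp \<and> w \<in> part L 0 \<and> central_mod w \<and> B w w \<noteq> 0 \<and>
     (\<forall>x\<in>perp. \<exists>c. x - scal L c w \<in> I))"
proof (cases "perp \<subseteq> I")
  case True
  then show ?thesis using I_perp by auto
next
  case False
  have even: "d = 0" if "w \<in> perp" "w \<notin> I" "w \<in> part L d" "central_mod w" for w d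
  proof (rule ccontr)
    assume "d \<noteq> 0"
    then have "sg (d * d) = (- 1 :: 'k)" using bit_cases[of d] by (auto simp: sg_1)
    then have "2 * B w w = 0" using B_supersymmetric[OF that(3,3)] by simp
    then show False using square_zero_mem[OF that(1,3,4)] that(2) two by simp
  qed
  obtain w d where w0: "w \<in> perp" "w \<notin> I" "w \<in> part L d" "central_mod w"
    using central_mod_exists[OF perp_graded perp_closed False] by blast
  have wC: "w \<in> carrier L" using w0 perpD by auto
  have w: "w \<in> part L 0" "B w w \<noteq> 0"
    using even[OF w0] w0 square_zero_mem by auto
  define K where "K = {x \<in> perp. B x w = 0}"
  have K_graded: "graded_subset K"
    unfolding graded_subset_def
  proof (intro conjI ballI allI)
    show "K \<subseteq> carrier L" by (auto simp: K_def perpD)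
    fix x e assume x: "x \<in> K"
    have xC: "x \<in> carrier L" using x perpD by (auto simp: K_def)
    have "B (comp e x) w = 0"
    proof (cases "e = 0")
      case True
      then show ?thesis using x w(1) xC by (simp add: B_component_left K_def)
    next
      case False
      then show ?thesis using B_consistent[OF component_part[OF xC] w(1)] by simp
    qed
    then show "comp e x \<in> K" using x graded_subsetD(2)[OF perp_graded] by (auto simp: K_def)
  qed
  have K_closed: "brk_closed K"
    unfolding brk_closed_def
  proof (intro allI ballI impI)
    fix xs y assume y: "y \<in> K" and xs: "set xs \<subseteq> carrier L \<and> length xs = n - 1"
    (* The odd component of w is zero, so {w} alone would not be a graded set. *)
    have W: "graded_subset {w, 0}"
      using wC graded_subset_part[OF w(1), of "{w, 0}"] graded_subset_part[OF zero_part, of "{w, 0}"]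
      by (auto simp: graded_subset_def)
    have "B (brk L (xs @ [y])) w = 0"
    proof (rule brk_orthogonal[OF K_graded W])
      fix x' xs' y' assume *: "x' \<in> K" "set xs' \<subseteq> carrier L" "length xs' = n - 1" "y' \<in> {w, 0}"
      have "brk L (xs' @ [y']) \<in> I"
      proof (cases "y' = w")
        case True
        then show ?thesis using w0(4) * unfolding central_mod_def by blast
      next
        case False
        then show ?thesis using * I_closed subspace_0[OF I_subspace] unfolding brk_closed_def by blast
      qed
      then show "B x' (brk L (xs' @ [y'])) = 0" using * perpD(2) by (auto simp: K_def)
    qed (use xs y in auto)
    moreover have "brk L (xs @ [y]) \<in> perp" using perp_closed xs y by (auto simp: brk_closed_def K_def)
    ultimately show "brk L (xs @ [y]) \<in> K" by (simp add: K_def)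
  qed
  have KI: "K \<subseteq> I"
  proof (rule ccontr)
    assume "\<not> K \<subseteq> I"
    then obtain v e where v0: "v \<in> K" "v \<notin> I" "v \<in> part L e" "central_mod v"
      using central_mod_exists[OF K_graded K_closed] by blast
    have vp: "v \<in> perp" and vw: "B v w = 0" using v0 by (auto simp: K_def)
    have vC: "v \<in> carrier L" using vp perpD by auto
    have v: "v \<in> part L 0" using even[OF vp v0(2-4)] v0(3) by simp
    have wv: "B w v = 0" using B_supersymmetric[OF w(1) v] vw by simp
    obtain c where c: "c ^ 2 = - B v v / B w w"
      using nth_root_exists[of 2 "- B v v / B w w"] by auto
    let ?u = "v + scal L c w"
    have "B ?u ?u = B v v + c ^ 2 * B w w"
      using vC wC vw wv by (simp add: B_add_left B_add_right B_scale_left B_scale_right power2_eq_square)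
    also have "\<dots> = 0" using c w by simp
    finally have uu: "B ?u ?u = 0" .
    have "?u \<in> I"
    proof (rule square_zero_mem[OF _ _ _ uu])
      show "?u \<in> perp" using vp w0 by (intro subspace_add[OF perp_subspace] subspace_scale[OF perp_subspace])
      show "?u \<in> part L 0" using v w by (intro subspace_add[OF subspace_part] subspace_scale[OF subspace_part])
      show "central_mod ?u"
        unfolding central_mod_def
      proof (intro allI impI)
        fix xs assume xs: "set xs \<subseteq> carrier L \<and> length xs = n - 1"
        have "brk L (xs @ [?u]) = brk L (xs @ [v]) + scal L c (brk L (xs @ [w]))"
          using xs vC wC by (simp add: brk_last_add brk_last_scale)
        also have "\<dots> \<in> I"
          using xs v0(4) w0(4) unfolding central_mod_def
          by (intro subspace_add[OF I_subspace] subspace_scale[OF I_subspace]) auto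
        finally show "brk L (xs @ [?u]) \<in> I" .
      qed
    qed
    then have "B ?u w = 0" using w0(1) by (intro I_orthogonal_perp)
    then have "c = 0" using vC wC vw w by (simp add: B_add_left B_scale_left)
    then show False using \<open>?u \<in> I\<close> v0(2) by simp
  qed
  have "\<exists>c. x - scal L c w \<in> I" if x: "x \<in> perp" for x
  proof -
    have "x - scal L (B x w / B w w) w \<in> K"
      using x w0(1) w(2) wC perpD
      by (auto simp: K_def B_diff_left B_scale_left intro!: subspace_diff[OF perp_subspace] subspace_scale[OF perp_subspace])
    then show ?thesis using KI by blast
  qed
  then show ?thesis using w0 w by blast
qed

lemma perp_central_mod: "x \<in> perp \<Longrightarrow> central_mod x"
proof -
  assume x: "x \<in> perp"
  consider "perp = I" | w where "w \<in> perp" "central_mod w" "\<exists>c. x - scal L c w \<in> I"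
    using perp_dichotomy x by blast
  then show ?thesis
  proof cases
    case 1
    then show ?thesis using x I_closed by (auto simp: central_mod_def brk_closed_def)
  next
    case 2
    then obtain c where c: "x - scal L c w \<in> I" by blast
    show ?thesis
      unfolding central_mod_def
    proof (intro allI impI)
      fix xs assume xs: "set xs \<subseteq> carrier L \<and> length xs = n - 1"
      have "brk L (xs @ [(x - scal L c w) + scal L c w]) = brk L (xs @ [x - scal L c w]) + scal L c (brk L (xs @ [w]))"
        using xs I_carrier[OF c] perpD(1)[OF 2(1)] by (simp only: brk_last_add brk_last_scale carrier_closed)
      also have "\<dots> \<in> I"
        using xs c 2 I_closed unfolding central_mod_def brk_closed_def
        by (intro subspace_add[OF I_subspace] subspace_scale[OF I_subspace]) auto
      finally show "brk L (xs @ [x]) \<in> I" by simp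
    qed
  qed
qed

text \<open>
  For a graded projection \<open>p\<close> with kernel \<open>I\<close> and adjoint \<open>q\<close>, the map \<open>(1 + p - q) / 2\<close> has the adjoint
  \<open>(1 + q - p) / 2\<close>, and the two add up to \<open>1\<close>. On \<open>I\<close> it vanishes: there \<open>p\<close> is zero, and \<open>q\<close> is the
  identity because \<open>I\<close> is orthogonal to \<open>y - p y\<close>. Being adjoint to a map that vanishes on \<open>I\<close>,
  \<open>1 - \<sigma>\<close> maps into \<open>perp\<close>, and brackets with \<open>perp\<close> fall into \<open>I\<close>.
\<close>

lemma half_splitting_exists: "\<exists>\<sigma>. half_splitting n L B \<sigma> \<and> (\<forall>x\<in>I. \<sigma> x = 0)"
proof -
  obtain p where p: "even_map p" "\<And>x. x \<in> I \<Longrightarrow> p x = 0" "\<And>x. x \<in> carrier L \<Longrightarrow> x - p x \<in> I"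
    using graded_projection[OF I_subspace I_graded] by blast
  obtain q where q: "even_map q" "\<And>x y. x \<in> carrier L \<Longrightarrow> y \<in> carrier L \<Longrightarrow> B (q x) y = B x (p y)"
    using adjoint_exists[OF p(1)] by blast
  note pC = even_map_carrier[OF p(1)] and qC = even_map_carrier[OF q(1)]
  have q': "B x (q y) = B (p x) y" if "x \<in> carrier L" "y \<in> carrier L" for x y
    using B_adjoint_swap[OF p(1) q(1) q(2) that] by simp
  define \<sigma> where "\<sigma> x = scal L (1 / 2) (x + p x - q x)" for x
  have \<sigma>C: "\<sigma> x \<in> carrier L" if "x \<in> carrier L" for x using that pC qC by (auto simp: \<sigma>_def)
  have \<sigma>0: "\<sigma> x = 0" if x: "x \<in> I" for x
  proof -
    have xC: "x \<in> carrier L" using x by (rule I_carrier)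
    have "q x = x"
    proof (rule B_eqI)
      fix y assume y: "y \<in> carrier L"
      have "B x (y - p y) = 0" using x p(3)[OF y] by (rule I_isotropic)
      then show "B (q x) y = B x y" using xC y pC by (simp add: q(2) B_diff_right)
    qed (use xC qC in auto)
    then show ?thesis using p(2)[OF x] by (simp add: \<sigma>_def)
  qed
  have half: "B (\<sigma> x) y + B x (\<sigma> y) = B x y" if x: "x \<in> carrier L" and y: "y \<in> carrier L" for x y
  proof -
    have l: "B (\<sigma> x) y = (B x y + B (p x) y - B x (p y)) / 2"
      using x y pC qC by (simp add: \<sigma>_def B_scale_left B_diff_left B_add_left q(2))
    have r: "B x (\<sigma> y) = (B x y + B x (p y) - B (p x) y) / 2"
      using x y pC qC by (simp add: \<sigma>_def B_scale_right B_diff_right B_add_right q')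
    have "(B x y + B (p x) y - B x (p y)) + (B x y + B x (p y) - B (p x) y) = 2 * B x y"
      by (simp add: algebra_simps)
    then have "B (\<sigma> x) y + B x (\<sigma> y) = 2 * B x y / 2"
      unfolding l r add_divide_distrib[symmetric] by (rule arg_cong)
    then show ?thesis using two by simp
  qed
  have rest: "y - \<sigma> y \<in> perp" if y: "y \<in> carrier L" for y
  proof -
    have "B (y - \<sigma> y) i = 0" if i: "i \<in> I" for i
      using half[OF y I_carrier[OF i]] y I_carrier[OF i] \<sigma>C[OF y] \<sigma>0[OF i] by (simp add: B_diff_left)
    then show ?thesis using y \<sigma>C by (auto simp: perp_def)
  qed
  have "half_splitting n L B \<sigma>"
  proof (unfold_locales)
    have "\<sigma> x \<in> part L d" if "x \<in> part L d" for x d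
      unfolding \<sigma>_def using even_mapD(3)[OF p(1) that] even_mapD(3)[OF q(1) that] that
      by (intro subspace_scale[OF subspace_part] subspace_diff[OF subspace_part] subspace_add[OF subspace_part])
    then show "even_map \<sigma>"
      using even_mapD(1,2)[OF p(1)] even_mapD(1,2)[OF q(1)]
      by (auto simp: even_map_def linear_map_on_def \<sigma>_def scale_right_distrib scale_right_diff_distrib
          mult.commute)
    show "B (\<sigma> x) y + B x (\<sigma> y) = B x y" if "x \<in> carrier L" "y \<in> carrier L" for x y
      using half that .
    fix xs y assume xs: "set xs \<subseteq> carrier L" "length xs = n" and y: "y \<in> carrier L" "y - \<sigma> y \<in> set xs"
    obtain i where i: "i < n" "xs ! i = y - \<sigma> y" using y xs by (auto simp: in_set_conv_nth)
    have "brk L xs \<in> I"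
    proof (rule brk_mem_any_position[OF perp_graded I_subspace _ xs i(1)])
      show "xs ! i \<in> perp" using i rest[OF y(1)] by simp
      show "brk L (zs @ [z]) \<in> I" if "set zs \<subseteq> carrier L" "length zs = n - 1" "z \<in> perp" for zs z
        using perp_central_mod that unfolding central_mod_def by blast
    qed
    then show "\<sigma> (brk L xs) = 0" by (rule \<sigma>0)
  qed
  then show ?thesis using \<sigma>0 by blast
qed

text \<open>
  The map \<open>\<tau>\<close> takes its values in \<open>perp\<close>, and \<open>\<sigma>\<close> vanishes on \<open>I\<close>. So \<open>\<sigma> \<circ> \<tau>\<close> is zero if \<open>perp = I\<close>;
  otherwise \<open>\<tau> w\<close> is a multiple of \<open>w\<close> modulo \<open>I\<close>, nonzero since \<open>B (\<tau> w) w = B w w / 2\<close>, and \<open>\<sigma> \<circ> \<tau>\<close> has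
  rank one with image spanned by \<open>\<sigma> w\<close>.
\<close>

lemma extension_exists:
  assumes m: "lc m \<subseteq> I"
  shows "\<exists>(\<hh> :: ('k, 'a) super_alg) \<theta>.
    n_lie_superalgebra n \<hh> \<and> lower_central n \<hh> m = {0} \<and>
    \<theta> \<in> even_cocycles n \<hh> \<and> cyclic_condition n \<hh> \<theta> \<and>
    (isometric n L B (Tstar n \<hh> \<theta>) (Tstar_form \<hh>) \<or>
     (\<exists>J. nondegenerate_ideal n (Tstar n \<hh> \<theta>) (Tstar_form \<hh>) J \<and>
          codimension_one (Tstar n \<hh> \<theta>) J \<and>
          isometric n L B (restrict_to (Tstar n \<hh> \<theta>) J) (Tstar_form \<hh>)))"
proof -
  obtain \<sigma> where "half_splitting n L B \<sigma>" and \<sigma>0: "\<And>x. x \<in> I \<Longrightarrow> \<sigma> x = 0"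
    using half_splitting_exists by blast
  then interpret S: half_splitting n L B \<sigma> by blast
  interpret H: n_lie_space n S.half_alg by standard (use n_pos S.half_n_lie in auto)
  have "lower_central n S.half_alg m \<subseteq> {0}"
    using S.half_lower_central[of m] m \<sigma>0 by auto
  then have nil: "lower_central n S.half_alg m = {0}"
    using S.H.subspace_0[OF H.lc_subspace[of m]] by auto
  have \<tau>_perp: "S.\<tau> x \<in> perp" if x: "x \<in> carrier L" for x
  proof -
    have "B (S.\<tau> x) i = 0" if "i \<in> I" for i
      using S.B_\<tau>_left[OF x I_carrier[OF that]] \<sigma>0[OF that] x by simp
    then show ?thesis using x by (simp add: perp_def)
  qed
  have "isometric n L B S.T (Tstar_form S.half_alg) \<or>
     (\<exists>J. nondegenerate_ideal n S.T (Tstar_form S.half_alg) J \<and> codimension_one S.T J \<and>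
          isometric n L B (restrict_to S.T J) (Tstar_form S.half_alg))"
    using perp_dichotomy
  proof
    assume "perp = I"
    then have "\<sigma> (S.\<tau> x) = 0" if "x \<in> carrier L" for x using \<tau>_perp[OF that] \<sigma>0 by simp
    then show ?thesis using S.isometric_Tstar by blast
  next
    assume "\<exists>w. w \<in> perp \<and> w \<in> part L 0 \<and> central_mod w \<and> B w w \<noteq> 0 \<and>
      (\<forall>x\<in>perp. \<exists>c. x - scal L c w \<in> I)"
    then obtain w where w: "w \<in> perp" "w \<in> part L 0" "B w w \<noteq> 0"
      and gen: "\<And>x. x \<in> perp \<Longrightarrow> \<exists>c. x - scal L c w \<in> I" by blast
    have wC: "w \<in> carrier L" using w(1) by (rule perpD)
    have "B (\<sigma> w) w = B w (\<sigma> w)"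
      using B_supersymmetric[OF S.\<sigma>_part[OF w(2)] w(2)] by simp
    then have B\<sigma>: "B w (\<sigma> w) \<noteq> 0" "B (\<sigma> w) w \<noteq> 0" using S.\<sigma>_half[OF wC wC] w(3) by auto
    obtain c where c: "S.\<tau> w - scal L c w \<in> I" using gen \<tau>_perp wC by blast
    have "B (S.\<tau> w - scal L c w) w = 0" using w(1) c by (rule I_orthogonal_perp)
    then have "B w (\<sigma> w) = c * B w w" using wC by (simp add: B_diff_left B_scale_left S.B_\<tau>_left)
    then have c0: "c \<noteq> 0" using B\<sigma> by auto
    have \<sigma>\<tau>: "\<sigma> (S.\<tau> x) = scal L b (\<sigma> w)" if "x \<in> carrier L" "S.\<tau> x - scal L b w \<in> I" for x b
      using \<sigma>0[OF that(2)] that(1) wC by (simp add: S.\<sigma>_diff S.\<sigma>_scale)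
    have "\<sigma> w \<noteq> 0" using B\<sigma> wC by auto
    then have "\<sigma> (S.\<tau> w) \<noteq> 0" using \<sigma>\<tau>[OF wC c] c0 by simp
    moreover have "\<exists>k. \<sigma> (S.\<tau> (v - scal L k w)) = 0" if v: "v \<in> carrier L" for v
    proof -
      obtain b where b: "S.\<tau> v - scal L b w \<in> I" using gen \<tau>_perp v by blast
      have "\<sigma> (S.\<tau> (v - scal L (b / c) w)) = \<sigma> (S.\<tau> v) - scal L (b / c) (\<sigma> (S.\<tau> w))"
        using v wC by (simp add: S.\<tau>_def S.\<sigma>_diff S.\<sigma>_scale scale_right_diff_distrib)
      also have "\<dots> = 0" using \<sigma>\<tau>[OF v b] \<sigma>\<tau>[OF wC c] c0 by simp
      finally show ?thesis by blast
    qed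
    ultimately have "codimension_one S.T (S.emb ` carrier L)"
      using S.emb_image_codimension_one[OF wC] by blast
    then show ?thesis using S.emb_image_nondegenerate_ideal S.isometric_restricted by blast
  qed
  then show ?thesis
    using S.half_n_lie nil S.half_cocycle_mem S.half_cocycle_cyclic by blast
qed

end

theorem theorem4p12:
  fixes n :: nat
    and \<gg> :: "('k::alg_closed_field, 'a::ab_group_add) super_alg"
    and B :: "'a \<Rightarrow> 'a \<Rightarrow> 'k"
  assumes "n \<ge> 1"
    and "CHAR('k) \<noteq> 2"
    and "n_lie_superalgebra n \<gg>"
    and "finite_dimensional \<gg>"
    and "nilpotent n \<gg>"
    and "is_metric n \<gg> B"
  shows "\<exists>(\<hh> :: ('k, 'a) super_alg) \<theta>.
           n_lie_superalgebra n \<hh> \<and> nilpotent n \<hh> \<and>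
           nilpotent_length n \<hh> \<le> (nilpotent_length n \<gg> + 1) div 2 \<and>
           \<theta> \<in> even_cocycles n \<hh> \<and> cyclic_condition n \<hh> \<theta> \<and>
           (isometric n \<gg> B (Tstar n \<hh> \<theta>) (Tstar_form \<hh>) \<or>
            (\<exists>I. nondegenerate_ideal n (Tstar n \<hh> \<theta>) (Tstar_form \<hh>) I \<and>
                 codimension_one (Tstar n \<hh> \<theta>) I \<and>
                 isometric n \<gg> B (restrict_to (Tstar n \<hh> \<theta>) I) (Tstar_form \<hh>)))"
proof -
  interpret finite_metric_n_lie_space n \<gg> B by unfold_locales (use assms in auto)
  define k where "k = nilpotent_length n \<gg>"
  define m where "m = (k + 1) div 2"
  have k: "lc k = {0}"
    using assms(5) unfolding k_def nilpotent_def nilpotent_length_def by (rule LeastI_ex)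
  have two: "(2::'k) \<noteq> 0"
  proof
    assume "(2::'k) = 0"
    then have "of_nat 2 = (0::'k)" by simp
    then have "CHAR('k) dvd 2" unfolding of_nat_eq_0_iff_char_dvd .
    then have "CHAR('k) = 1 \<or> CHAR('k) = 2"
      using two_is_prime_nat unfolding prime_nat_iff by blast
    then show False using assms(2) by simp
  qed
  have "isotropic_ideal (lc m)"
    by (rule lc_isotropic_ideal[OF k]) (simp add: m_def)
  then obtain I where I: "isotropic_ideal I" "lc m \<subseteq> I"
    "\<And>I'. isotropic_ideal I' \<Longrightarrow> I \<subseteq> I' \<Longrightarrow> I' = I"
    using maximal_isotropic_ideal_exists by blast
  interpret M: maximal_isotropic_ideal n \<gg> B I
    by unfold_locales (use two k I in blast)+
  obtain \<hh> :: "('k, 'a) super_alg" and \<theta> where h: "n_lie_superalgebra n \<hh>" "lower_central n \<hh> m = {0}"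
    "\<theta> \<in> even_cocycles n \<hh>" "cyclic_condition n \<hh> \<theta>"
    "isometric n \<gg> B (Tstar n \<hh> \<theta>) (Tstar_form \<hh>) \<or>
     (\<exists>J. nondegenerate_ideal n (Tstar n \<hh> \<theta>) (Tstar_form \<hh>) J \<and>
          codimension_one (Tstar n \<hh> \<theta>) J \<and>
          isometric n \<gg> B (restrict_to (Tstar n \<hh> \<theta>) J) (Tstar_form \<hh>))"
    using M.extension_exists[OF I(2)] by blast
  have "nilpotent n \<hh>" using h(2) by (auto simp: nilpotent_def)
  moreover have "nilpotent_length n \<hh> \<le> (nilpotent_length n \<gg> + 1) div 2"
    unfolding nilpotent_length_def[of n \<hh>] k_def[symmetric] m_def[symmetric]
    using h(2) by (rule Least_le)
  ultimately show ?thesis using h by blast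
qed

end
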